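(* Let $\varphi$ and $\varphi(s,t,x)$ be as in the context, and let $E$ be a subset of $\mathbb{C}$. There exists a divergent formal power series $f(y,t,x)\in\mathbb{C}[[y,t,x]]$ such that $E=\operatorname{Conv}_\varphi(f)$ if and only if $E$ is an $F_\sigma$ set of zero capacity.
   Context: Let $n\ge 1$ and $x=(x_1,\dots,x_n)$. A formal power series $\sum_\alpha a_\alpha z^\alpha$ in finitely many variables is called convergent if there is a constant $C$ with $|a_\alpha|\le C^{|\alpha|}$ for all multi-indices $\alpha\neq 0$ (equivalently, it has a nonempty open polydisc of convergence); otherwise it is divergent. Fix a convergent power series $\varphi(t,x)=\sum_{j\ge1}b_j(x)t^j$, where each $b_j(x)=\sum_{i}b_{ji}x^i\in\mathbb{C}[[x]]$ is convergent (sum over multi-indices $i$), and assume $b_1(0)=b_{10}=1$. For $s\in\mathbb{C}$ put $\varphi(s,t,x)=\varphi_s(t,x)=s\,b_1(x)t+\sum_{j\ge2}b_j(x)t^j$. For $f(y,t,x)\in\mathbb{C}[[y,t,x]]$ ($y,t$ single variables), define $\operatorname{Conv}_\varphi(f)=\{s\in\mathbb{C}: f(\varphi(s,t,x),t,x)\text{ converges as a power series in }(t,x)\}$. Capacity means logarithmic capacity $\mathfrak{c}$ (equal, for compact sets, to the Chebyshev constant / transfinite diameter). An $F_\sigma$ set $E\subset\mathbb{C}$ is said to have zero capacity if $\mathfrak{c}(E\cap\{|z|\le r\})=0$ for every $r\ge0$. *)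

theory Defs
  imports "HOL-Analysis.Analysis"
begin

text \<open>Multi-indices for x = (x_1,...,x_n) are functions 'n => nat with 'n a finite
  (nonempty) index type, so n = CARD('n) >= 1.  A series in x is 'n-multiindex => complex,
  a series in (t,x) is nat => ('n => nat) => complex (first argument = power of t),
  a series in (y,t,x) is nat => nat => ('n => nat) => complex (powers of y, t, x).\<close>

definition mdeg :: "('n::finite \<Rightarrow> nat) \<Rightarrow> nat" where
  "mdeg \<beta> = (\<Sum>i\<in>UNIV. \<beta> i)"

definition conv_x :: "(('n::finite \<Rightarrow> nat) \<Rightarrow> complex) \<Rightarrow> bool" where
  "conv_x g \<longleftrightarrow> (\<exists>C::real. \<forall>\<beta>. \<beta> \<noteq> (\<lambda>_. 0) \<longrightarrow> norm (g \<beta>) \<le> C ^ mdeg \<beta>)"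

definition conv_tx :: "(nat \<Rightarrow> ('n::finite \<Rightarrow> nat) \<Rightarrow> complex) \<Rightarrow> bool" where
  "conv_tx g \<longleftrightarrow> (\<exists>C::real. \<forall>m \<beta>. (m \<noteq> 0 \<or> \<beta> \<noteq> (\<lambda>_. 0)) \<longrightarrow>
      norm (g m \<beta>) \<le> C ^ (m + mdeg \<beta>))"

definition conv_ytx :: "(nat \<Rightarrow> nat \<Rightarrow> ('n::finite \<Rightarrow> nat) \<Rightarrow> complex) \<Rightarrow> bool" where
  "conv_ytx f \<longleftrightarrow> (\<exists>C::real. \<forall>k m \<beta>. (k \<noteq> 0 \<or> m \<noteq> 0 \<or> \<beta> \<noteq> (\<lambda>_. 0)) \<longrightarrow>
      norm (f k m \<beta>) \<le> C ^ (k + m + mdeg \<beta>))"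

definition mul_tx :: "(nat \<Rightarrow> ('n::finite \<Rightarrow> nat) \<Rightarrow> complex) \<Rightarrow> (nat \<Rightarrow> ('n \<Rightarrow> nat) \<Rightarrow> complex)
    \<Rightarrow> nat \<Rightarrow> ('n \<Rightarrow> nat) \<Rightarrow> complex" where
  "mul_tx g h m \<beta> = (\<Sum>j\<le>m. \<Sum>\<gamma>\<in>{\<gamma>. \<forall>i. \<gamma> i \<le> \<beta> i}. g j \<gamma> * h (m - j) (\<lambda>i. \<beta> i - \<gamma> i))"

definition one_tx :: "nat \<Rightarrow> ('n::finite \<Rightarrow> nat) \<Rightarrow> complex" where
  "one_tx m \<beta> = (if m = 0 \<and> \<beta> = (\<lambda>_. 0) then 1 else 0)"

fun pow_tx :: "(nat \<Rightarrow> ('n::finite \<Rightarrow> nat) \<Rightarrow> complex) \<Rightarrow> nat \<Rightarrow> nat \<Rightarrow> ('n \<Rightarrow> nat) \<Rightarrow> complex" where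
  "pow_tx g 0 = one_tx"
| "pow_tx g (Suc k) = mul_tx g (pow_tx g k)"

text \<open>Substitution y := g(t,x) into f(y,t,x), for g without t^0 terms (g 0 _ = 0):
  then g^k has t-order >= k, so the coefficient of t^m x^beta only receives
  contributions from k <= m; the formal composition is
  sum_k f_k(t,x) g(t,x)^k, where f_k is the coefficient of y^k.\<close>
definition subst_y :: "(nat \<Rightarrow> nat \<Rightarrow> ('n::finite \<Rightarrow> nat) \<Rightarrow> complex) \<Rightarrow> (nat \<Rightarrow> ('n \<Rightarrow> nat) \<Rightarrow> complex)
    \<Rightarrow> nat \<Rightarrow> ('n \<Rightarrow> nat) \<Rightarrow> complex" where
  "subst_y f g m \<beta> = (\<Sum>k\<le>m. mul_tx (f k) (pow_tx g k) m \<beta>)"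

definition phi :: "(nat \<Rightarrow> ('n::finite \<Rightarrow> nat) \<Rightarrow> complex) \<Rightarrow> nat \<Rightarrow> ('n \<Rightarrow> nat) \<Rightarrow> complex" where
  "phi b m \<beta> = (if m = 0 then 0 else b m \<beta>)"

definition phi_s :: "(nat \<Rightarrow> ('n::finite \<Rightarrow> nat) \<Rightarrow> complex) \<Rightarrow> complex \<Rightarrow> nat \<Rightarrow> ('n \<Rightarrow> nat) \<Rightarrow> complex" where
  "phi_s b s m \<beta> = (if m = 0 then 0 else if m = 1 then s * b 1 \<beta> else b m \<beta>)"

definition Conv_phi :: "(nat \<Rightarrow> ('n::finite \<Rightarrow> nat) \<Rightarrow> complex) \<Rightarrow> (nat \<Rightarrow> nat \<Rightarrow> ('n \<Rightarrow> nat) \<Rightarrow> complex)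
    \<Rightarrow> complex set" where
  "Conv_phi b f = {s. conv_tx (subst_y f (phi_s b s))}"

definition diam_k :: "nat \<Rightarrow> complex set \<Rightarrow> real" where
  "diam_k k K = (if K = {} then 0 else
     Sup {(\<Prod>(i,j)\<in>{(i,j). i < j \<and> j < k}. cmod (z i - z j)) powr (2 / (real k * (real k - 1)))
          | z. \<forall>i<k. z i \<in> K})"

text \<open>Transfinite diameter (= logarithmic capacity) of a compact set.\<close>
definition transfinite_diameter :: "complex set \<Rightarrow> real" where
  "transfinite_diameter K = lim (\<lambda>k. diam_k k K)"

text \<open>Capacity of an arbitrary (bounded) set: inner capacity, sup over compact subsets
  (for Borel, in particular F_sigma, sets this agrees with the outer capacity).\<close>
definition capacity :: "complex set \<Rightarrow> real" where
  "capacity A = Sup {transfinite_diameter K | K. compact K \<and> K \<subseteq> A}"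

definition zero_capacity :: "complex set \<Rightarrow> bool" where
  "zero_capacity E \<longleftrightarrow> (\<forall>r::real. r \<ge> 0 \<longrightarrow> capacity (E \<inter> {z. cmod z \<le> r}) = 0)"

end

theory Submission
  imports Defs "HOL-Complex_Analysis.Conformal_Mappings"
    "HOL-Library.Function_Algebras" "HOL-Library.Product_Plus"
begin

text \<open>
  The substitution \<open>y = b\<^sub>1(x) Y + \<Sum>\<^bsub>j\<ge>2\<^esub> b\<^sub>j(x) t\<^sup>j\<close> is an automorphism of \<open>\<complex>[[y,t,x]]\<close> that preserves convergence
  in both directions and turns \<open>f(\<phi>\<^sub>s(t,x),t,x)\<close> into \<open>g(st,t,x)\<close>, so one may assume \<open>\<phi> = t\<close>. The coefficient of
  \<open>t\<^sup>m x\<^sup>\<beta>\<close> in \<open>g(st,t,x)\<close> is then a polynomial in \<open>s\<close> of degree at most \<open>m\<close>, and the only constraint on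
  these polynomials is their degree.

  The set where they are bounded by \<open>N\<^bsup>m+|\<beta>|\<^esup>\<close> is closed. If one of these sets supports no monic polynomials
  that are small compared with \<open>\<epsilon>\<^bsup>deg\<^esup>\<close>, a Bernstein--Walsh type estimate bounds all coefficients of \<open>g\<close>, and
  \<open>g\<close> converges. Otherwise weighted products of small monic polynomials, which are small on neighbourhoods of
  these sets, show that every compact subset of their union has transfinite diameter zero.

  Conversely, let \<open>E\<close> be the increasing union of compact sets \<open>K\<^sub>N\<close> of capacity zero. Normalised powers of
  monic polynomials that are small on \<open>K\<^sub>N\<close> give \<open>P\<^sub>m\<close> such that \<open>|P\<^sub>m|\<^bsup>1/m\<^esup>\<close> is at most 1 on \<open>K\<^sub>N\<close>, at least
  \<open>N\<close> at distance \<open>1/j\<close> from \<open>K\<^sub>N\<close>, and locally bounded by a multiple of \<open>N\<close> independent of \<open>j\<close>; placing one such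
  polynomial for each pair \<open>(N, j)\<close> at a different \<open>m\<close> makes \<open>E\<close> the convergence set.
\<close>

section \<open>Formal power series\<close>

text \<open>Finiteness of the set of decompositions turns the Cauchy product into a finite sum. The
  property passes to pairs and to finite powers, hence to the exponents of series in
  \<open>(t,x)\<close>.\<close>

class index_monoid = comm_monoid_add +
  assumes finite_decompositions: "finite {(a, b). a + b = c}"

instance nat :: index_monoid
proof
  fix c :: nat
  have "{(a, b). a + b = c} \<subseteq> {..c} \<times> {..c}" by auto
  then show "finite {(a, b). a + b = c}" by (rule finite_subset) auto
qed

instance "fun" :: (finite, index_monoid) index_monoid
proof
  fix c :: "'a \<Rightarrow> 'b"
  let ?D = "PiE UNIV (\<lambda>i. {(a, b). a + b = c i})"
  have "{(a, b). a + b = c} \<subseteq> (\<lambda>h. (\<lambda>i. fst (h i), \<lambda>i. snd (h i))) ` ?D"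
  proof clarify
    fix a b :: "'a \<Rightarrow> 'b"
    assume "c = a + b"
    then have "(\<lambda>i. (a i, b i)) \<in> PiE UNIV (\<lambda>i. {(x, y). x + y = (a + b) i})"
      by auto
    then show "(a, b) \<in> (\<lambda>h. (\<lambda>i. fst (h i), \<lambda>i. snd (h i))) ` PiE UNIV (\<lambda>i. {(x, y). x + y = (a + b) i})"
      by (intro image_eqI[of _ _ "\<lambda>i. (a i, b i)"]) auto
  qed
  moreover have "finite ?D"
    using finite_decompositions[of "c _"] by (intro finite_PiE) auto
  ultimately show "finite {(a, b). a + b = c}"
    by (meson finite_imageI finite_subset)
qed

instance prod :: (index_monoid, index_monoid) index_monoid
proof
  fix c :: "'a \<times> 'b"
  have "{(a, b). a + b = c} \<subseteq> (\<lambda>((a, b), (a', b')). ((a, a'), (b, b'))) `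
      ({(a, b). a + b = fst c} \<times> {(a, b). a + b = snd c})"
    by (force simp: image_iff)
  moreover have "finite ({(a, b). a + b = fst c} \<times> {(a, b). a + b = snd c})"
    by (intro finite_cartesian_product finite_decompositions)
  ultimately show "finite {(a, b). a + b = c}"
    by (meson finite_imageI finite_subset)
qed

text \<open>On plain functions, multiplication and powers are pointwise. A separate type lets them
  denote the Cauchy product, and its ring instance supplies the binomial theorem.\<close>

typedef 'a fser = "UNIV :: ('a \<Rightarrow> complex) set"
  morphisms coef Fser ..

setup_lifting type_definition_fser

lemma coef_Fser [simp]: "coef (Fser f) = f"
  by (simp add: Fser_inverse)

lemma fser_eqI: "(\<And>c. coef u c = coef v c) \<Longrightarrow> u = v"
  by (metis coef_inverse ext)

instantiation fser :: (index_monoid) comm_ring_1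
begin

lift_definition zero_fser :: "'a fser" is "\<lambda>_. 0" .
lift_definition one_fser :: "'a fser" is "\<lambda>c. if c = 0 then 1 else 0" .
lift_definition plus_fser :: "'a fser \<Rightarrow> 'a fser \<Rightarrow> 'a fser" is "\<lambda>u v c. u c + v c" .
lift_definition minus_fser :: "'a fser \<Rightarrow> 'a fser \<Rightarrow> 'a fser" is "\<lambda>u v c. u c - v c" .
lift_definition uminus_fser :: "'a fser \<Rightarrow> 'a fser" is "\<lambda>u c. - u c" .
lift_definition times_fser :: "'a fser \<Rightarrow> 'a fser \<Rightarrow> 'a fser"
  is "\<lambda>u v c. \<Sum>(a, b)\<in>{(a, b). a + b = c}. u a * v b" .

instance
proof
  fix u v w :: "'a fser"
  show "u * v = v * u"
  proof (transfer, rule ext)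
    fix u v :: "'a \<Rightarrow> complex" and c
    show "(\<Sum>(a, b)\<in>{(a, b). a + b = c}. u a * v b) = (\<Sum>(a, b)\<in>{(a, b). a + b = c}. v a * u b)"
      by (rule sum.reindex_bij_witness[of _ prod.swap prod.swap]) (auto simp: add.commute)
  qed
  show "u * v * w = u * (v * w)"
  proof (transfer, rule ext)
    fix u v w :: "'a \<Rightarrow> complex" and c
    let ?D = "\<lambda>c. {(a, b). a + b = (c :: 'a)}"
    have fin: "finite (?D c)" for c
      by (rule finite_decompositions)
    have "(\<Sum>(p, q)\<in>?D c. (\<Sum>(a, b)\<in>?D p. u a * v b) * w q)
        = (\<Sum>x\<in>?D c. \<Sum>y\<in>?D (fst x). u (fst y) * v (snd y) * w (snd x))"
      by (simp add: sum_distrib_right case_prod_beta)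
    also have "\<dots> = (\<Sum>z\<in>Sigma (?D c) (\<lambda>x. ?D (fst x)). u (fst (snd z)) * v (snd (snd z)) * w (snd (fst z)))"
      by (subst sum.Sigma) (auto simp: fin case_prod_beta)
    \<comment> \<open>Both double sums run over the triples with total \<open>c\<close>; the
      bijection only moves the bracket.\<close>
    also have "\<dots> = (\<Sum>z\<in>Sigma (?D c) (\<lambda>x. ?D (snd x)). u (fst (fst z)) * v (fst (snd z)) * w (snd (snd z)))"
      by (rule sum.reindex_bij_witness[of _ "\<lambda>((p, q), (a, b)). ((p + a, b), (p, a))"
            "\<lambda>((p, q), (a, b)). ((a, b + q), (b, q))"]) (auto simp: add.assoc)
    also have "\<dots> = (\<Sum>x\<in>?D c. \<Sum>y\<in>?D (snd x). u (fst x) * v (fst y) * w (snd y))"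
      by (subst sum.Sigma) (auto simp: fin case_prod_beta)
    also have "\<dots> = (\<Sum>(p, q)\<in>?D c. u p * (\<Sum>(a, b)\<in>?D q. v a * w b))"
      by (simp add: sum_distrib_left case_prod_beta mult.assoc)
    finally show "(\<Sum>(p, q)\<in>?D c. (\<Sum>(a, b)\<in>?D p. u a * v b) * w q)
        = (\<Sum>(p, q)\<in>?D c. u p * (\<Sum>(a, b)\<in>?D q. v a * w b))" .
  qed
  show "1 * u = u"
  proof (transfer, rule ext)
    fix u :: "'a \<Rightarrow> complex" and c
    have "(\<Sum>(a, b)\<in>{(a, b). a + b = c}. (if a = 0 then 1 else 0) * u b)
        = (\<Sum>(a, b)\<in>{(0 :: 'a, c)}. (if a = 0 then 1 else 0) * u b)"
      by (rule sum.mono_neutral_right) (auto simp: finite_decompositions split: if_splits)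
    then show "(\<Sum>(a, b)\<in>{(a, b). a + b = c}. (if a = 0 then 1 else 0) * u b) = u c"
      by simp
  qed
  show "(u + v) * w = u * w + v * w"
    by (transfer, rule ext) (simp add: case_prod_beta algebra_simps sum.distrib)
  show "(0 :: 'a fser) \<noteq> 1"
    by transfer (auto dest: fun_cong[of _ _ 0])
qed (transfer; simp add: fun_eq_iff algebra_simps)+

end

lemma coef_zero [simp]: "coef 0 c = 0" by transfer simp
lemma coef_one: "coef 1 c = (if c = 0 then 1 else 0)" by transfer simp
lemma coef_add [simp]: "coef (u + v) c = coef u c + coef v c" by transfer simp
lemma coef_diff [simp]: "coef (u - v) c = coef u c - coef v c" by transfer simp
lemma coef_minus [simp]: "coef (- u) c = - coef u c" by transfer simp
lemma coef_mult: "coef (u * v) c = (\<Sum>(a, b)\<in>{(a, b). a + b = c}. coef u a * coef v b)"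
  by transfer simp

lemma coef_sum [simp]: "coef (sum h A) c = (\<Sum>k\<in>A. coef (h k) c)"
  by (induction A rule: infinite_finite_induct) auto

definition fmonom :: "'a \<Rightarrow> complex \<Rightarrow> 'a fser" where
  "fmonom a k = Fser (\<lambda>c. if c = a then k else 0)"

lemma coef_fmonom: "coef (fmonom a k) c = (if c = a then k else 0)"
  by (simp add: fmonom_def)

lemma fmonom_0_1: "fmonom 0 1 = (1 :: 'a::index_monoid fser)"
  by (rule fser_eqI) (simp add: coef_fmonom coef_one)

lemma fmonom_mult: "fmonom a k * fmonom b l = fmonom (a + b :: 'a::index_monoid) (k * l)"
proof (rule fser_eqI)
  fix c :: 'a
  have "coef (fmonom a k * fmonom b l) c
      = (\<Sum>p\<in>{(x, y). x + y = c}. if p = (a, b) then k * l else 0)"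
    unfolding coef_mult by (intro sum.cong) (auto simp: coef_fmonom split: if_splits)
  also have "\<dots> = coef (fmonom (a + b) (k * l)) c"
    by (subst sum.delta) (auto simp: coef_fmonom finite_decompositions)
  finally show "coef (fmonom a k * fmonom b l) c = coef (fmonom (a + b) (k * l)) c" .
qed

lemma of_nat_fser: "(of_nat n :: 'a::index_monoid fser) = fmonom 0 (of_nat n)"
  by (induction n) (auto intro!: fser_eqI simp: coef_fmonom coef_one)

text \<open>Truncation at an additive degree \<open>d\<close>; below, \<open>d\<close> is either the order in \<open>t\<close> or the total degree.\<close>

definition additive_degree :: "('a::index_monoid \<Rightarrow> nat) \<Rightarrow> bool" where
  "additive_degree d \<longleftrightarrow> (\<forall>a b. d (a + b) = d a + d b)"

lemma additive_degree_zero: "additive_degree d \<Longrightarrow> d 0 = 0"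
  unfolding additive_degree_def by (metis add_cancel_right_right add.right_neutral)

lemma coef_mult_cong:
  assumes "additive_degree d" "d c \<le> m"
    and "\<And>c. d c \<le> m \<Longrightarrow> coef u c = coef u' c" "\<And>c. d c \<le> m \<Longrightarrow> coef v c = coef v' c"
  shows "coef (u * v) c = coef (u' * v') c"
  unfolding coef_mult
proof (rule sum.cong, goal_cases)
  case (2 p)
  obtain a b where "p = (a, b)" by (cases p)
  with 2 have "d a + d b = d c" using assms(1) by (auto simp: additive_degree_def)
  then show ?case using assms \<open>p = (a, b)\<close> by simp
qed simp

lemma coef_mult_eq_0:
  assumes "additive_degree d" "d c < m + n"
    and "\<And>c. d c < m \<Longrightarrow> coef u c = 0" "\<And>c. d c < n \<Longrightarrow> coef v c = 0"
  shows "coef (u * v) c = 0"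
  unfolding coef_mult
proof (rule sum.neutral, clarify)
  fix a b assume "c = a + b"
  then have "d a < m \<or> d b < n" using assms(1,2) by (auto simp: additive_degree_def)
  then show "coef u a * coef v b = 0" using assms(3,4) by auto
qed

lemma coef_power_eq_0:
  assumes "additive_degree d" "\<And>c. d c = 0 \<Longrightarrow> coef u c = 0" "d c < n"
  shows "coef (u ^ n) c = 0"
  using assms(3)
proof (induction n arbitrary: c)
  case (Suc n)
  then show ?case
    using coef_mult_eq_0[OF assms(1), of c 1 n u "u ^ n"] assms(2) by simp
qed simp

section \<open>Weighted norms and affine substitution\<close>

text \<open>A weighted l1 norm, for \<open>tdeg\<close> the norm of absolute convergence on the
  polydisc of radius \<open>r\<close>. Finite partial sums avoid any summability side condition, and
  the norm is submultiplicative.\<close>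

definition wbound :: "('a \<Rightarrow> nat) \<Rightarrow> real \<Rightarrow> real \<Rightarrow> 'a fser \<Rightarrow> bool" where
  "wbound d r B u \<longleftrightarrow> (\<forall>F. finite F \<longrightarrow> (\<Sum>c\<in>F. cmod (coef u c) * r ^ d c) \<le> B)"

lemma wboundD: "wbound d r B u \<Longrightarrow> finite F \<Longrightarrow> (\<Sum>c\<in>F. cmod (coef u c) * r ^ d c) \<le> B"
  by (simp add: wbound_def)

lemma wbound_nonneg: "wbound d r B u \<Longrightarrow> 0 \<le> B"
  using wboundD[of d r B u "{}"] by simp

lemma wbound_coef: "wbound d r B u \<Longrightarrow> cmod (coef u c) * r ^ d c \<le> B"
  using wboundD[of d r B u "{c}"] by simp

lemma wbound_mono:
  assumes "wbound d r B u" "0 \<le> r'" "r' \<le> r" "B \<le> B'"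
  shows "wbound d r' B' u"
  unfolding wbound_def
proof clarify
  fix F :: "'a set" assume "finite F"
  have "(\<Sum>c\<in>F. cmod (coef u c) * r' ^ d c) \<le> (\<Sum>c\<in>F. cmod (coef u c) * r ^ d c)"
    using assms by (intro sum_mono mult_left_mono power_mono) auto
  also have "\<dots> \<le> B" by (rule wboundD) fact+
  finally show "(\<Sum>c\<in>F. cmod (coef u c) * r' ^ d c) \<le> B'" using assms by simp
qed

text \<open>Every index in the support has degree at least 1, so shrinking the radius by
  \<open>l\<close> gains at least one factor \<open>l\<close>. In this way series without constant
  term are made small.\<close>

lemma wbound_scale:
  assumes "wbound d r B u" "0 \<le> r" "0 \<le> l" "l \<le> 1" "\<And>c. d c = 0 \<Longrightarrow> coef u c = 0"
  shows "wbound d (l * r) (l * B) u"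
  unfolding wbound_def
proof clarify
  fix F :: "'a set" assume "finite F"
  have "(\<Sum>c\<in>F. cmod (coef u c) * (l * r) ^ d c) \<le> (\<Sum>c\<in>F. l * (cmod (coef u c) * r ^ d c))"
  proof (rule sum_mono)
    fix c
    show "cmod (coef u c) * (l * r) ^ d c \<le> l * (cmod (coef u c) * r ^ d c)"
    proof (cases "d c")
      case (Suc n)
      have "l ^ d c \<le> l" using assms Suc by (simp add: mult_left_le power_le_one)
      then have "l ^ d c * (cmod (coef u c) * r ^ d c) \<le> l * (cmod (coef u c) * r ^ d c)"
        using assms by (intro mult_right_mono) auto
      then show ?thesis by (simp add: power_mult_distrib mult_ac)
    qed (use assms in simp)
  qed
  also have "\<dots> \<le> l * B"
    using wboundD[OF assms(1) \<open>finite F\<close>] assms by (simp add: sum_distrib_left[symmetric] mult_left_mono)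
  finally show "(\<Sum>c\<in>F. cmod (coef u c) * (l * r) ^ d c) \<le> l * B" .
qed

text \<open>Serves series that are defined coefficientwise through truncations: a bound uniform in
  the truncation carries over.\<close>

lemma wbound_locally:
  assumes "\<And>F. finite F \<Longrightarrow> \<exists>v. wbound d r B v \<and> (\<forall>c\<in>F. coef u c = coef v c)"
  shows "wbound d r B u"
  unfolding wbound_def
proof clarify
  fix F :: "'a set" assume F: "finite F"
  then obtain v where "wbound d r B v" "\<forall>c\<in>F. coef u c = coef v c" using assms by blast
  then show "(\<Sum>c\<in>F. cmod (coef u c) * r ^ d c) \<le> B"
    using wboundD[of d r B v F] F by simp
qed

lemma wbound_zero: "wbound d r 0 (0 :: 'a::index_monoid fser)"
  by (simp add: wbound_def)

lemma wbound_add: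
  assumes "wbound d r A u" "wbound d r B (v :: 'a::index_monoid fser)" "0 \<le> r"
  shows "wbound d r (A + B) (u + v)"
  unfolding wbound_def
proof clarify
  fix F :: "'a set" assume F: "finite F"
  have "(\<Sum>c\<in>F. cmod (coef (u + v) c) * r ^ d c)
      \<le> (\<Sum>c\<in>F. cmod (coef u c) * r ^ d c) + (\<Sum>c\<in>F. cmod (coef v c) * r ^ d c)"
    unfolding sum.distrib[symmetric] using assms(3)
    by (intro sum_mono) (simp add: distrib_right[symmetric] mult_right_mono norm_triangle_ineq)
  also have "\<dots> \<le> A + B" using wboundD[OF assms(1) F] wboundD[OF assms(2) F] by simp
  finally show "(\<Sum>c\<in>F. cmod (coef (u + v) c) * r ^ d c) \<le> A + B" .
qed

lemma wbound_minus: "wbound d r B u \<Longrightarrow> wbound d r B (- u :: 'a::index_monoid fser)"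
  by (simp add: wbound_def)

lemma wbound_sum:
  assumes "\<And>k. k \<in> I \<Longrightarrow> wbound d r (B k) (u k :: 'a::index_monoid fser)" "0 \<le> r"
  shows "wbound d r (sum B I) (sum u I)"
  using assms(1) by (induction I rule: infinite_finite_induct) (auto intro: wbound_add wbound_zero assms(2))

lemma wbound_mult:
  assumes "wbound d r A u" "wbound d r B (v :: 'a::index_monoid fser)" "0 \<le> r" and d: "additive_degree d"
  shows "wbound d r (A * B) (u * v)"
  unfolding wbound_def
proof clarify
  fix F :: "'a set" assume F: "finite F"
  let ?D = "\<lambda>c. {(a, b). a + b = (c :: 'a)}"
  let ?g = "\<lambda>p. (cmod (coef u (fst p)) * r ^ d (fst p)) * (cmod (coef v (snd p)) * r ^ d (snd p))"
  define P where "P = (\<Union>c\<in>F. ?D c)"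
  have finP: "finite P" unfolding P_def using F by (intro finite_UN_I finite_decompositions)
  have "(\<Sum>c\<in>F. cmod (coef (u * v) c) * r ^ d c) \<le> (\<Sum>c\<in>F. \<Sum>p\<in>?D c. ?g p)"
  proof (rule sum_mono)
    fix c
    have "cmod (coef (u * v) c) * r ^ d c \<le> (\<Sum>(a, b)\<in>?D c. cmod (coef u a * coef v b)) * r ^ d c"
      unfolding coef_mult using assms(3)
      by (intro mult_right_mono order_trans[OF norm_sum]) (auto simp: case_prod_beta)
    also have "\<dots> = (\<Sum>p\<in>?D c. ?g p)"
      unfolding sum_distrib_right
      using d by (intro sum.cong) (auto simp: norm_mult additive_degree_def power_add)
    finally show "cmod (coef (u * v) c) * r ^ d c \<le> (\<Sum>p\<in>?D c. ?g p)" .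
  qed
  also have "\<dots> = (\<Sum>p\<in>P. ?g p)"
    unfolding P_def using F by (subst sum.UNION_disjoint) (auto simp: finite_decompositions)
  \<comment> \<open>The decomposition sets of distinct \<open>c\<close> are disjoint; enlarging
    their union to the rectangle of its projections makes the sum factor.\<close>
  also have "\<dots> \<le> (\<Sum>p\<in>fst ` P \<times> snd ` P. ?g p)"
    using finP assms(3) by (intro sum_mono2) (force simp: image_iff)+
  also have "\<dots> = (\<Sum>a\<in>fst ` P. cmod (coef u a) * r ^ d a) * (\<Sum>b\<in>snd ` P. cmod (coef v b) * r ^ d b)"
    unfolding sum_product by (subst sum.cartesian_product) (simp add: case_prod_beta)
  also have "\<dots> \<le> A * B"
    using assms(1,2,3) finP by (intro mult_mono wboundD wbound_nonneg[OF assms(1)] sum_nonneg) auto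
  finally show "(\<Sum>c\<in>F. cmod (coef (u * v) c) * r ^ d c) \<le> A * B" .
qed

lemma wbound_fmonom_0:
  assumes "additive_degree d"
  shows "wbound d r (cmod k) (fmonom (0 :: 'a::index_monoid) k)"
  unfolding wbound_def
proof clarify
  fix F :: "'a set" assume "finite F"
  have "(\<Sum>c\<in>F. cmod (coef (fmonom 0 k) c) * r ^ d c) = (\<Sum>c\<in>F. if c = 0 then cmod k else 0)"
    using additive_degree_zero[OF assms] by (intro sum.cong) (auto simp: coef_fmonom)
  then show "(\<Sum>c\<in>F. cmod (coef (fmonom 0 k) c) * r ^ d c) \<le> cmod k"
    using \<open>finite F\<close> by simp
qed

lemma wbound_power:
  assumes "wbound d r A (u :: 'a::index_monoid fser)" "0 \<le> r" "additive_degree d"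
  shows "wbound d r (A ^ n) (u ^ n)"
proof (induction n)
  case 0
  show ?case using wbound_fmonom_0[OF assms(3), of r 1] by (simp add: fmonom_0_1)
qed (auto intro: wbound_mult assms)

lemma sum_half_powers_le: "(\<Sum>k\<in>{i..L}. (1/2 :: real) ^ (k - i)) \<le> 2"
proof -
  have "(\<Sum>k\<in>{i..L}. (1/2 :: real) ^ (k - i)) = (\<Sum>e\<in>(\<lambda>k. k - i) ` {i..L}. (1/2) ^ e)"
    by (subst sum.reindex) (auto simp: inj_on_def)
  also have "\<dots> \<le> (\<Sum>e. (1/2 :: real) ^ e)"
    by (intro sum_le_suminf) (auto simp: summable_geometric)
  finally show ?thesis by (simp add: suminf_geometric)
qed

section \<open>Inversion and affine substitution\<close>

text \<open>Geometric series for \<open>1 / (1 - h)\<close> with \<open>h = 1 - a\<close>. Since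
  \<open>h\<close> has no constant term, a smaller radius brings its norm down to 1/2, and the
  inverse then has norm at most 2.\<close>

lemma inverse_fser_exists:
  fixes a :: "'a::index_monoid fser"
  assumes d: "additive_degree d" "\<And>c. d c = 0 \<Longrightarrow> c = 0"
    and a: "coef a 0 = 1" "wbound d r B a" "r > 0"
  shows "\<exists>a' r'. r' > 0 \<and> a * a' = 1 \<and> wbound d r' 2 a'"
proof -
  define h where "h = 1 - a"
  have h0: "d c = 0 \<Longrightarrow> coef h c = 0" for c
    using d(2)[of c] a(1) by (simp add: h_def coef_one)
  have hb: "wbound d r (1 + B) h"
    unfolding h_def diff_conv_add_uminus
    using wbound_power[of d r B a 0] a d by (intro wbound_add wbound_minus) auto
  define l where "l = 1 / (2 * (1 + B))"
  have "B \<ge> 0" using a(2) wbound_nonneg by blast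
  then have l: "0 < l" "l \<le> 1" "l * (1 + B) = 1/2" by (auto simp: l_def field_simps)
  define r' where "r' = l * r"
  have r': "r' > 0" using l a by (simp add: r'_def)
  have hb': "wbound d r' (1/2) h"
    using wbound_scale[OF hb, of l] l a h0 by (simp add: r'_def)
  \<comment> \<open>\<open>h ^ n\<close> has no terms of degree below \<open>n\<close>, so the
    partial sum up to \<open>d c\<close> already gives the coefficient at \<open>c\<close>.\<close>
  define a' where "a' = Fser (\<lambda>c. coef (\<Sum>n\<le>d c. h ^ n) c)"
  have a'_coef: "coef a' c = coef (\<Sum>n\<le>L. h ^ n) c" if "d c \<le> L" for c L
  proof -
    have "(\<Sum>n\<le>L. coef (h ^ n) c) = (\<Sum>n\<le>d c. coef (h ^ n) c)"
      using that coef_power_eq_0[OF d(1), of h c] h0 by (intro sum.mono_neutral_right) auto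
    then show ?thesis by (simp add: a'_def)
  qed
  have "a * a' = 1"
  proof (rule fser_eqI)
    fix c
    have "coef (a * a') c = coef (a * (\<Sum>n\<le>d c. h ^ n)) c"
      by (rule coef_mult_cong[OF d(1) order_refl]) (auto simp: a'_coef simp del: coef_sum)
    also have "a * (\<Sum>n\<le>d c. h ^ n) = 1 - h ^ Suc (d c)"
      using one_diff_power_eq[of h "Suc (d c)"] by (simp add: h_def lessThan_Suc_atMost)
    also have "coef \<dots> c = coef 1 c"
      using coef_power_eq_0[OF d(1), of h c "Suc (d c)"] h0 by (simp del: power_Suc)
    finally show "coef (a * a') c = coef 1 c" .
  qed
  moreover have "wbound d r' 2 a'"
  proof (rule wbound_locally)
    fix F :: "'a set" assume F: "finite F"
    define L where "L = Max (insert 0 (d ` F))"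
    have L: "d c \<le> L" if "c \<in> F" for c using F that by (simp add: L_def)
    have "wbound d r' (\<Sum>n\<le>L. (1/2) ^ n) (\<Sum>n\<le>L. h ^ n)"
      using hb' r' d by (intro wbound_sum wbound_power) auto
    then have "wbound d r' 2 (\<Sum>n\<le>L. h ^ n)"
      by (rule wbound_mono) (use r' sum_half_powers_le[of 0 L] in \<open>auto simp: atLeast0AtMost\<close>)
    then show "\<exists>v. wbound d r' 2 v \<and> (\<forall>c\<in>F. coef a' c = coef v c)"
      using L a'_coef by blast
  qed
  ultimately show ?thesis using r' by blast
qed

text \<open>The coefficients of \<open>f(a y + p)\<close> as a series in \<open>y\<close>, where \<open>p\<close> has positive order with respect to \<open>d\<close>;
  only the terms with \<open>k \<le> i + d c\<close> contribute to the coefficient of index \<open>c\<close>.\<close>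

definition affine_subst :: "('a \<Rightarrow> nat) \<Rightarrow> 'a fser \<Rightarrow> 'a fser \<Rightarrow> (nat \<Rightarrow> 'a fser) \<Rightarrow> nat \<Rightarrow> 'a::index_monoid fser" where
  "affine_subst d a p f i =
     Fser (\<lambda>c. coef (\<Sum>k\<le>i + d c. of_nat (k choose i) * f k * a ^ i * p ^ (k - i)) c)"

lemma coef_affine_subst:
  assumes d: "additive_degree d" and p: "\<And>c. d c = 0 \<Longrightarrow> coef p c = 0" and L: "i + d c \<le> L"
  shows "coef (affine_subst d a p f i) c
    = coef (\<Sum>k\<le>L. of_nat (k choose i) * f k * a ^ i * p ^ (k - i)) c"
proof -
  have "coef (of_nat (k choose i) * f k * a ^ i * p ^ (k - i)) c = 0" if "k > i + d c" for k
    by (rule coef_mult_eq_0[OF d, of _ 0 "k - i"]) (use that coef_power_eq_0[OF d] p in auto)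
  then have "(\<Sum>k\<le>L. coef (of_nat (k choose i) * f k * a ^ i * p ^ (k - i)) c)
      = (\<Sum>k\<le>i + d c. coef (of_nat (k choose i) * f k * a ^ i * p ^ (k - i)) c)"
    using L by (intro sum.mono_neutral_right) auto
  then show ?thesis by (simp add: affine_subst_def)
qed

text \<open>Both sides are the coefficient of \<open>y ^ j\<close> in
  \<open>(a * (y + q) + p) ^ k\<close>. The identity for \<open>(k choose i) * (i choose j)\<close>
  reduces the left one to the binomial theorem.\<close>

lemma sum_choose_affine:
  fixes a q p :: "'a::comm_ring_1"
  assumes "j \<le> k" "k \<le> L"
  shows "(\<Sum>i\<le>L. of_nat (i choose j) * of_nat (k choose i) * a ^ i * q ^ (i - j) * p ^ (k - i))
      = of_nat (k choose j) * a ^ j * (a * q + p) ^ (k - j)"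
proof -
  have "(\<Sum>i\<le>L. of_nat (i choose j) * of_nat (k choose i) * a ^ i * q ^ (i - j) * p ^ (k - i))
      = (\<Sum>i\<in>{j..k}. of_nat (i choose j) * of_nat (k choose i) * a ^ i * q ^ (i - j) * p ^ (k - i))"
    using assms by (intro sum.mono_neutral_right) (auto simp: not_le binomial_eq_0)
  also have "\<dots> = (\<Sum>e\<le>k - j. of_nat (k choose j) * a ^ j *
      (of_nat ((k - j) choose e) * (a * q) ^ e * p ^ (k - j - e)))"
  proof (rule sum.reindex_bij_witness[of _ "\<lambda>e. e + j" "\<lambda>i. i - j"], goal_cases)
    case (5 i)
    then have "(k choose i) * (i choose j) = (k choose j) * ((k - j) choose (i - j))"
      by (intro choose_mult) auto
    then have eq: "of_nat (i choose j) * of_nat (k choose i)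
        = (of_nat (k choose j) * of_nat ((k - j) choose (i - j)) :: 'a)"
      by (metis mult.commute of_nat_mult)
    have "a ^ i = a ^ j * a ^ (i - j)" using 5 by (simp flip: power_add)
    moreover have "k - j - (i - j) = k - i" using 5 by simp
    ultimately show ?case unfolding eq by (simp add: power_mult_distrib mult_ac)
  qed (use assms in auto)
  also have "\<dots> = of_nat (k choose j) * a ^ j * (a * q + p) ^ (k - j)"
    by (simp only: binomial_ring sum_distrib_left)
  finally show ?thesis .
qed

text \<open>The composite replaces \<open>y\<close> by \<open>a * (a' * y + q) + p\<close>, and the
  two equations make this equal to \<open>y\<close>.\<close>

lemma affine_subst_inverse:
  fixes a :: "'a::index_monoid fser"
  assumes d: "additive_degree d"
    and p: "\<And>c. d c = 0 \<Longrightarrow> coef p c = 0" and q: "\<And>c. d c = 0 \<Longrightarrow> coef q c = 0"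
    and aa': "a * a' = 1" and pq: "a * q + p = 0"
  shows "affine_subst d a' q (affine_subst d a p f) = f"
proof (rule ext, rule fser_eqI)
  fix j c
  \<comment> \<open>The outer sum needs \<open>i \<le> j + d c\<close>, and the truncation defining
    the inner coefficient needs \<open>i + d c\<close>; \<open>L\<close> covers both.\<close>
  define L where "L = j + 2 * d c"
  let ?T = "\<lambda>i k. of_nat (k choose i) * f k * a ^ i * p ^ (k - i)"
  let ?g = "affine_subst d a p f"
  have "coef (affine_subst d a' q ?g j) c
      = (\<Sum>i\<le>L. coef (of_nat (i choose j) * ?g i * a' ^ j * q ^ (i - j)) c)"
    by (subst coef_affine_subst[OF d q, of _ _ L]) (auto simp: L_def)
  also have "\<dots> = (\<Sum>i\<le>L. coef (of_nat (i choose j) * (\<Sum>k\<le>L. ?T i k) * a' ^ j * q ^ (i - j)) c)"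
  proof (rule sum.cong[OF refl])
    fix i
    show "coef (of_nat (i choose j) * ?g i * a' ^ j * q ^ (i - j)) c
        = coef (of_nat (i choose j) * (\<Sum>k\<le>L. ?T i k) * a' ^ j * q ^ (i - j)) c"
    proof (cases "i \<le> j + d c")
      case True
      then have "\<And>x. d x \<le> d c \<Longrightarrow> coef (?g i) x = coef (\<Sum>k\<le>L. ?T i k) x"
        by (intro coef_affine_subst[OF d p]) (auto simp: L_def)
      then show ?thesis by (intro coef_mult_cong[OF d order_refl]) auto
    next
      case False
      then have "coef (u * q ^ (i - j)) c = 0" for u
        by (intro coef_mult_eq_0[OF d, of _ 0 "i - j"]) (use coef_power_eq_0[OF d] q in auto)
      then show ?thesis by simp
    qed
  qed
  also have "\<dots> = coef (\<Sum>i\<le>L. \<Sum>k\<le>L. of_nat (i choose j) * ?T i k * a' ^ j * q ^ (i - j)) c"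
    by (simp only: coef_sum sum_distrib_left sum_distrib_right)
  also have "(\<Sum>i\<le>L. \<Sum>k\<le>L. of_nat (i choose j) * ?T i k * a' ^ j * q ^ (i - j))
      = (\<Sum>k\<le>L. f k * a' ^ j * (\<Sum>i\<le>L. of_nat (i choose j) * of_nat (k choose i) * a ^ i * q ^ (i - j) * p ^ (k - i)))"
    by (subst sum.swap) (simp add: sum_distrib_left mult_ac)
  also have "\<dots> = (\<Sum>k\<le>L. if k = j then f j else 0)"
  proof (rule sum.cong[OF refl], goal_cases)
    case (1 k)
    show ?case
    proof (cases "j \<le> k")
      case True
      then have "(\<Sum>i\<le>L. of_nat (i choose j) * of_nat (k choose i) * a ^ i * q ^ (i - j) * p ^ (k - i))
          = of_nat (k choose j) * a ^ j * 0 ^ (k - j)"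
        using 1 by (subst sum_choose_affine) (auto simp: pq)
      moreover have "a' ^ j * a ^ j = 1" using aa' by (simp add: mult.commute flip: power_mult_distrib)
      ultimately show ?thesis using True by (auto simp: mult.assoc power_0_left)
    next
      case False
      have "i < j \<or> k < i" for i using False by linarith
      then have "of_nat (i choose j) * of_nat (k choose i) = (0 :: 'a fser)" for i
        by (metis binomial_eq_0 mult_zero_left mult_zero_right of_nat_0)
      then show ?thesis using False by (simp add: mult.assoc[symmetric])
    qed
  qed
  also have "coef \<dots> c = coef (f j) c" by (simp add: L_def)
  finally show "coef (affine_subst d a' q ?g j) c = coef (f j) c" .
qed

text \<open>Splitting \<open>k choose i \<le> 2 ^ k\<close> as \<open>2 ^ i * 2 ^ (k - i)\<close>
  leaves a factor \<open>2 * D * P \<le> 1/2\<close> to the power \<open>k - i\<close>, so the sum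
  over \<open>k\<close> is geometric. Here \<open>d\<close> governs truncation and \<open>d'\<close>
  the weights; they are used with the order in \<open>t\<close> and the total degree.\<close>

lemma affine_subst_wbound:
  fixes a :: "'a::index_monoid fser"
  assumes d: "additive_degree d" and p: "\<And>c. d c = 0 \<Longrightarrow> coef p c = 0"
    and d': "additive_degree d'" and r: "0 \<le> r" and D: "0 \<le> D"
    and f: "\<And>k. wbound d' r (B * D ^ k) (f k)" and a: "wbound d' r A a" and pP: "wbound d' r P p"
    and small: "4 * D * P \<le> 1"
  shows "wbound d' r (2 * B * (2 * D * A) ^ i) (affine_subst d a p f i)"
proof (rule wbound_locally)
  fix F :: "'a set" assume F: "finite F"
  define L where "L = i + Max (insert 0 (d ` F))"
  have L: "i + d c \<le> L" if "c \<in> F" for c using F that by (simp add: L_def)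
  let ?T = "\<lambda>k. of_nat (k choose i) * f k * a ^ i * p ^ (k - i)"
  have nn: "0 \<le> B" "0 \<le> A" "0 \<le> P"
    using wbound_nonneg[OF f[of 0]] a pP wbound_nonneg by auto
  have T: "wbound d' r (B * (2 * D * A) ^ i * (1/2) ^ (k - i)) (?T k)" if "i \<le> k" for k
  proof -
    have "wbound d' r (real (k choose i) * (B * D ^ k) * A ^ i * P ^ (k - i)) (?T k)"
      using f a pP d' r wbound_fmonom_0[OF d', of r "of_nat (k choose i)"]
      by (intro wbound_mult wbound_power) (auto simp: of_nat_fser)
    moreover have "real (k choose i) * (B * D ^ k) * A ^ i * P ^ (k - i) \<le> B * (2 * D * A) ^ i * (1/2) ^ (k - i)"
    proof -
      have "k choose i \<le> 2 ^ k" by (rule binomial_le_pow2)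
      then have "real (k choose i) \<le> 2 ^ k" by (metis of_nat_le_iff of_nat_numeral of_nat_power)
      then have "real (k choose i) * (B * D ^ k * A ^ i * P ^ (k - i)) \<le> 2 ^ k * (B * D ^ k * A ^ i * P ^ (k - i))"
        using nn D by (intro mult_right_mono) auto
      also have "\<dots> = B * (2 * D * A) ^ i * (2 * D * P) ^ (k - i)"
      proof -
        have "(2 * D) ^ k = (2 * D) ^ i * (2 * D) ^ (k - i)"
          using that by (metis le_add_diff_inverse power_add)
        then show ?thesis by (simp add: power_mult_distrib mult_ac)
      qed
      also have "\<dots> \<le> B * (2 * D * A) ^ i * (1/2) ^ (k - i)"
        using nn D small by (intro mult_left_mono power_mono) auto
      finally show ?thesis by (simp add: mult_ac)
    qed
    ultimately show ?thesis using r wbound_mono[OF _ r order_refl] by blast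
  qed
  have "wbound d' r (\<Sum>k\<in>{i..L}. B * (2 * D * A) ^ i * (1/2) ^ (k - i)) (\<Sum>k\<in>{i..L}. ?T k)"
    using T r by (intro wbound_sum) auto
  moreover have "(\<Sum>k\<in>{i..L}. ?T k) = (\<Sum>k\<le>L. ?T k)"
    by (intro sum.mono_neutral_left) (auto simp: not_le binomial_eq_0)
  moreover have "(\<Sum>k\<in>{i..L}. B * (2 * D * A) ^ i * (1/2) ^ (k - i)) \<le> 2 * B * (2 * D * A) ^ i"
    using mult_left_mono[OF sum_half_powers_le[of i L], of "B * (2 * D * A) ^ i"] nn D
    by (simp add: sum_distrib_left mult_ac)
  ultimately have "wbound d' r (2 * B * (2 * D * A) ^ i) (\<Sum>k\<le>L. ?T k)"
    using wbound_mono[OF _ r order_refl] by simp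
  then show "\<exists>v. wbound d' r (2 * B * (2 * D * A) ^ i) v \<and> (\<forall>c\<in>F. coef (affine_subst d a p f i) c = coef v c)"
    using coef_affine_subst[OF d p] L by blast
qed

section \<open>Series in \<open>(t,x)\<close> and the reduction to \<open>y = s t\<close>\<close>

definition tdeg :: "nat \<times> ('n::finite \<Rightarrow> nat) \<Rightarrow> nat" where
  "tdeg c = fst c + mdeg (snd c)"

definition tx :: "(nat \<Rightarrow> ('n::finite \<Rightarrow> nat) \<Rightarrow> complex) \<Rightarrow> (nat \<times> ('n \<Rightarrow> nat)) fser" where
  "tx g = Fser (\<lambda>(m, \<beta>). g m \<beta>)"

lemma coef_tx [simp]: "coef (tx g) (m, \<beta>) = g m \<beta>"
  by (simp add: tx_def)

lemma tx_coef: "tx (\<lambda>m \<beta>. coef u (m, \<beta>)) = u"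
  by (rule fser_eqI) (auto simp: tx_def)

lemma additive_degree_fst: "additive_degree fst"
  by (auto simp: additive_degree_def)

lemma mdeg_add: "mdeg (\<beta> + \<gamma>) = mdeg \<beta> + mdeg \<gamma>"
  by (simp add: mdeg_def sum.distrib)

lemma mdeg_eq_0_iff: "mdeg \<beta> = 0 \<longleftrightarrow> \<beta> = (\<lambda>_. 0)"
  by (auto simp: mdeg_def fun_eq_iff)

lemma additive_degree_tdeg: "additive_degree tdeg"
  by (auto simp: additive_degree_def tdeg_def mdeg_add)

lemma tdeg_eq_0_iff: "tdeg c = 0 \<longleftrightarrow> c = 0"
  by (cases c) (auto simp: tdeg_def mdeg_eq_0_iff zero_prod_def zero_fun_def)

lemma tx_mul_tx: "tx (mul_tx g h) = tx g * tx h"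
proof (rule fser_eqI, clarify)
  fix m :: nat and \<beta> :: "'a \<Rightarrow> nat"
  let ?G = "{\<gamma>. \<forall>i. \<gamma> i \<le> \<beta> i}"
  have G: "\<gamma> + (\<lambda>i. \<beta> i - \<gamma> i) = \<beta>" if "\<gamma> \<in> ?G" for \<gamma>
    using that by (auto simp: fun_eq_iff)
  have "coef (tx g * tx h) (m, \<beta>)
      = (\<Sum>(j, \<gamma>)\<in>{..m} \<times> ?G. g j \<gamma> * h (m - j) (\<lambda>i. \<beta> i - \<gamma> i))"
    unfolding coef_mult
    by (rule sum.reindex_bij_witness[of _ "\<lambda>(j, \<gamma>). ((j, \<gamma>), (m - j, \<lambda>i. \<beta> i - \<gamma> i))" fst])
      (auto simp: G)
  also have "\<dots> = mul_tx g h m \<beta>"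
    by (simp add: mul_tx_def sum.cartesian_product)
  finally show "coef (tx (mul_tx g h)) (m, \<beta>) = coef (tx g * tx h) (m, \<beta>)" by simp
qed

lemma tx_one_tx: "tx one_tx = 1"
  by (rule fser_eqI) (auto simp: coef_one one_tx_def zero_prod_def zero_fun_def split: if_splits)

lemma tx_pow_tx: "tx (pow_tx g k) = tx g ^ k"
  by (induction k) (auto simp: tx_mul_tx tx_one_tx)

lemma subst_y_eq: "subst_y f g m \<beta> = coef (\<Sum>k\<le>m. tx (f k) * tx g ^ k) (m, \<beta>)"
  by (simp add: subst_y_def coef_sum flip: tx_pow_tx tx_mul_tx)

text \<open>Enclosing \<open>F\<close> in a box makes the sum a product of geometric sums, one per
  variable, each at most 2.\<close>

lemma sum_power_mdeg_le:
  fixes q :: real and F :: "('n::finite \<Rightarrow> nat) set"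
  assumes "finite F" "0 \<le> q" "q \<le> 1/2"
  shows "(\<Sum>\<beta>\<in>F. q ^ mdeg \<beta>) \<le> 2 ^ CARD('n)"
proof -
  define M where "M = Max (insert 0 ((\<lambda>(\<beta>, i). \<beta> i) ` (F \<times> UNIV)))"
  have M: "\<beta> i \<le> M" if "\<beta> \<in> F" for \<beta> i
    unfolding M_def using assms(1) that by (intro Max_ge) (auto simp: image_iff)
  have "F \<subseteq> PiE (UNIV :: 'n set) (\<lambda>_. {..M})" using M by auto
  then have "(\<Sum>\<beta>\<in>F. q ^ mdeg \<beta>) \<le> (\<Sum>\<beta>\<in>PiE (UNIV :: 'n set) (\<lambda>_. {..M}). q ^ mdeg \<beta>)"
    using assms by (intro sum_mono2 finite_PiE) auto
  also have "\<dots> = (\<Prod>i\<in>(UNIV :: 'n set). \<Sum>k\<le>M. q ^ k)"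
    by (subst prod_sum_PiE) (auto simp: mdeg_def power_sum)
  also have "\<dots> \<le> (\<Prod>i\<in>(UNIV :: 'n set). 2)"
  proof (rule prod_mono)
    fix i :: 'n
    have "(\<Sum>k\<le>M. q ^ k) \<le> (\<Sum>k\<le>M. (1/2) ^ k)"
      using assms by (intro sum_mono power_mono) auto
    also have "\<dots> \<le> 2" using sum_half_powers_le[of 0 M] by (simp add: atLeast0AtMost)
    finally show "0 \<le> (\<Sum>k\<le>M. q ^ k) \<and> (\<Sum>k\<le>M. q ^ k) \<le> 2"
      using assms by (auto intro: sum_nonneg)
  qed
  also have "\<dots> = 2 ^ CARD('n)" by simp
  finally show ?thesis .
qed

lemma sum_power_tdeg_le:
  fixes q :: real and F :: "(nat \<times> ('n::finite \<Rightarrow> nat)) set"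
  assumes "finite F" "0 \<le> q" "q \<le> 1/2"
  shows "(\<Sum>c\<in>F. q ^ tdeg c) \<le> 2 * 2 ^ CARD('n)"
proof -
  define M where "M = Max (insert 0 (fst ` F))"
  have M: "fst c \<le> M" if "c \<in> F" for c using assms(1) that by (simp add: M_def)
  have "(\<Sum>c\<in>F. q ^ tdeg c) \<le> (\<Sum>c\<in>{..M} \<times> snd ` F. q ^ tdeg c)"
    using M assms by (intro sum_mono2) (force simp: image_iff)+
  also have "\<dots> = (\<Sum>m\<le>M. q ^ m) * (\<Sum>\<beta>\<in>snd ` F. q ^ mdeg \<beta>)"
    unfolding sum_product sum.cartesian_product by (simp add: tdeg_def power_add case_prod_beta)
  also have "\<dots> \<le> 2 * 2 ^ CARD('n)"
  proof (rule mult_mono)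
    have "(\<Sum>k\<le>M. q ^ k) \<le> (\<Sum>k\<le>M. (1/2) ^ k)"
      using assms by (intro sum_mono power_mono) auto
    then show "(\<Sum>k\<le>M. q ^ k) \<le> 2" using sum_half_powers_le[of 0 M] by (simp add: atLeast0AtMost)
  qed (use assms sum_power_mdeg_le[of "snd ` F" q] in \<open>auto intro: sum_nonneg\<close>)
  finally show ?thesis .
qed

lemma wbound_tdeg_of_coef_bound:
  fixes u :: "(nat \<times> ('n::finite \<Rightarrow> nat)) fser"
  assumes "\<And>c. cmod (coef u c) \<le> A * C ^ tdeg c" "0 \<le> A" "0 \<le> r" "0 \<le> C" "C * r \<le> 1/2"
  shows "wbound tdeg r (A * (2 * 2 ^ CARD('n))) u"
  unfolding wbound_def
proof clarify
  fix F :: "(nat \<times> ('n \<Rightarrow> nat)) set" assume F: "finite F"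
  have "(\<Sum>c\<in>F. cmod (coef u c) * r ^ tdeg c) \<le> (\<Sum>c\<in>F. A * (C * r) ^ tdeg c)"
    using assms mult_right_mono[OF assms(1)]
    by (intro sum_mono) (auto simp: power_mult_distrib mult.assoc[symmetric])
  also have "\<dots> = A * (\<Sum>c\<in>F. (C * r) ^ tdeg c)" by (simp add: sum_distrib_left)
  also have "\<dots> \<le> A * (2 * 2 ^ CARD('n))"
    using assms F by (intro mult_left_mono sum_power_tdeg_le) auto
  finally show "(\<Sum>c\<in>F. cmod (coef u c) * r ^ tdeg c) \<le> A * (2 * 2 ^ CARD('n))" .
qed

lemma conv_tx_imp_wbound:
  assumes "conv_tx g"
  shows "\<exists>r>0. \<exists>B. wbound tdeg r B (tx g)"
proof -
  obtain C0 where C0: "\<And>m \<beta>. m \<noteq> 0 \<or> \<beta> \<noteq> (\<lambda>_. 0) \<Longrightarrow> cmod (g m \<beta>) \<le> C0 ^ (m + mdeg \<beta>)"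
    using assms unfolding conv_tx_def by blast
  define C where "C = \<bar>C0\<bar> + 1"
  \<comment> \<open>\<open>A\<close> takes care of the constant term, which \<open>conv_tx\<close>
    leaves unrestricted.\<close>
  define A where "A = cmod (g 0 (\<lambda>_. 0)) + 1"
  have "cmod (coef (tx g) c) \<le> A * C ^ tdeg c" for c
  proof (cases c)
    case (Pair m \<beta>)
    show ?thesis
    proof (cases "m \<noteq> 0 \<or> \<beta> \<noteq> (\<lambda>_. 0)")
      case True
      then have "cmod (g m \<beta>) \<le> \<bar>C0\<bar> ^ (m + mdeg \<beta>)"
        using C0 by (metis abs_ge_self order_trans power_abs)
      also have "\<dots> \<le> 1 * C ^ (m + mdeg \<beta>)" by (simp add: C_def power_mono)
      also have "\<dots> \<le> A * C ^ (m + mdeg \<beta>)" by (intro mult_right_mono) (auto simp: A_def C_def)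
      finally show ?thesis by (simp add: Pair tdeg_def)
    next
      case False
      then show ?thesis by (simp add: Pair tdeg_def mdeg_def A_def)
    qed
  qed
  then have "wbound tdeg (1 / (2 * C)) (A * (2 * 2 ^ CARD('a))) (tx g)"
    by (rule wbound_tdeg_of_coef_bound) (auto simp: A_def C_def)
  moreover have "1 / (2 * C) > 0" by (simp add: C_def)
  ultimately show ?thesis by blast
qed

text \<open>Convergence becomes geometric growth in \<open>k\<close> of the norms of the
  coefficients of \<open>y ^ k\<close>, which is the form that \<open>affine_subst_wbound\<close>
  preserves.\<close>

lemma conv_ytx_iff_wbound:
  "conv_ytx f \<longleftrightarrow> (\<exists>r>0. \<exists>B. \<exists>D\<ge>0. \<forall>k. wbound tdeg r (B * D ^ k) (tx (f k)))"
proof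
  assume "conv_ytx f"
  then obtain C0 where C0: "\<And>k m \<beta>. k \<noteq> 0 \<or> m \<noteq> 0 \<or> \<beta> \<noteq> (\<lambda>_. 0) \<Longrightarrow> cmod (f k m \<beta>) \<le> C0 ^ (k + m + mdeg \<beta>)"
    unfolding conv_ytx_def by blast
  define C where "C = \<bar>C0\<bar> + 1"
  define A where "A = cmod (f 0 0 (\<lambda>_. 0)) + 1"
  have "cmod (coef (tx (f k)) c) \<le> A * C ^ k * C ^ tdeg c" for k c
  proof (cases c)
    case (Pair m \<beta>)
    show ?thesis
    proof (cases "k \<noteq> 0 \<or> m \<noteq> 0 \<or> \<beta> \<noteq> (\<lambda>_. 0)")
      case True
      then have "cmod (f k m \<beta>) \<le> \<bar>C0\<bar> ^ (k + m + mdeg \<beta>)"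
        using C0 by (metis abs_ge_self order_trans power_abs)
      also have "\<dots> \<le> 1 * C ^ (k + m + mdeg \<beta>)" by (simp add: C_def power_mono)
      also have "\<dots> \<le> A * C ^ (k + m + mdeg \<beta>)" by (intro mult_right_mono) (auto simp: A_def C_def)
      finally show ?thesis by (simp add: Pair tdeg_def power_add mult_ac)
    next
      case False
      then show ?thesis by (simp add: Pair tdeg_def mdeg_def A_def)
    qed
  qed
  then have "wbound tdeg (1 / (2 * C)) (A * C ^ k * (2 * 2 ^ CARD('a))) (tx (f k))" for k
    by (rule wbound_tdeg_of_coef_bound) (auto simp: A_def C_def)
  then have "wbound tdeg (1 / (2 * C)) (A * (2 * 2 ^ CARD('a)) * C ^ k) (tx (f k))" for k
    by (simp add: mult_ac)
  moreover have "1 / (2 * C) > 0" "C \<ge> 0" by (auto simp: C_def)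
  ultimately show "\<exists>r>0. \<exists>B. \<exists>D\<ge>0. \<forall>k. wbound tdeg r (B * D ^ k) (tx (f k))" by blast
next
  assume "\<exists>r>0. \<exists>B. \<exists>D\<ge>0. \<forall>k. wbound tdeg r (B * D ^ k) (tx (f k))"
  then obtain r B D where r: "r > 0" and D: "D \<ge> 0" and b: "\<And>k. wbound tdeg r (B * D ^ k) (tx (f k))"
    by blast
  \<comment> \<open>All three factors of \<open>C\<close> are at least 1, so each exponent can be
    raised to the total degree. That degree is positive because the constant term is excluded, which
    lets a power of \<open>B'\<close> absorb \<open>B\<close>.\<close>
  define B' where "B' = max B 1"
  define C where "C = B' * (D + 1) * (1 / r + 1)"
  have "cmod (f k m \<beta>) \<le> C ^ (k + m + mdeg \<beta>)" if nz: "k \<noteq> 0 \<or> m \<noteq> 0 \<or> \<beta> \<noteq> (\<lambda>_. 0)" for k m \<beta>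
  proof -
    let ?N = "k + m + mdeg \<beta>"
    have N: "?N > 0" using nz mdeg_eq_0_iff[of \<beta>] by auto
    have "cmod (f k m \<beta>) * r ^ (m + mdeg \<beta>) \<le> B * D ^ k"
      using wbound_coef[OF b[of k], of "(m, \<beta>)"] by (simp add: tdeg_def)
    then have "cmod (f k m \<beta>) \<le> B * D ^ k * (1 / r) ^ (m + mdeg \<beta>)"
      using r by (simp add: field_simps power_divide)
    also have "\<dots> \<le> B' ^ ?N * (D + 1) ^ ?N * (1 / r + 1) ^ ?N"
    proof (intro mult_mono)
      have "B \<le> B' ^ 1" by (simp add: B'_def)
      also have "\<dots> \<le> B' ^ ?N" using N by (intro power_increasing) (auto simp: B'_def)
      finally show "B \<le> B' ^ ?N" .
      have "D ^ k \<le> (D + 1) ^ k" using D by (intro power_mono) auto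
      also have "\<dots> \<le> (D + 1) ^ ?N" using D by (intro power_increasing) auto
      finally show "D ^ k \<le> (D + 1) ^ ?N" .
      have "(1 / r) ^ (m + mdeg \<beta>) \<le> (1 / r + 1) ^ (m + mdeg \<beta>)" using r by (intro power_mono) auto
      also have "\<dots> \<le> (1 / r + 1) ^ ?N" using r by (intro power_increasing) auto
      finally show "(1 / r) ^ (m + mdeg \<beta>) \<le> (1 / r + 1) ^ ?N" .
    qed (use D r in \<open>auto simp: B'_def\<close>)
    also have "\<dots> = C ^ ?N" by (simp add: C_def power_mult_distrib)
    finally show ?thesis .
  qed
  then show "conv_ytx f" unfolding conv_ytx_def by blast
qed

lemma affine_subst_conv_ytx:
  fixes f :: "nat \<Rightarrow> nat \<Rightarrow> ('n::finite \<Rightarrow> nat) \<Rightarrow> complex"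
  assumes f: "conv_ytx f" and r: "r > 0"
    and a: "wbound tdeg r A a" and p: "wbound tdeg r P p" "\<And>c. fst c = 0 \<Longrightarrow> coef p c = 0"
  shows "conv_ytx (\<lambda>k m \<beta>. coef (affine_subst fst a p (\<lambda>k. tx (f k)) k) (m, \<beta>))"
proof -
  obtain r1 B D where r1: "r1 > 0" and D: "D \<ge> 0" and b: "\<And>k. wbound tdeg r1 (B * D ^ k) (tx (f k))"
    using f unfolding conv_ytx_iff_wbound by blast
  define r2 where "r2 = min r r1"
  have r2: "r2 > 0" using r r1 by (simp add: r2_def)
  have P: "P \<ge> 0" "A \<ge> 0" using a p wbound_nonneg by auto
  \<comment> \<open>\<open>p\<close> has no constant term, so shrinking the radius by
    \<open>l\<close> scales its norm by \<open>l\<close>; this choice gives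
    \<open>4 * D * (l * P) \<le> 1\<close>.\<close>
  define l where "l = 1 / (1 + 4 * D * P)"
  have l: "0 < l" "l \<le> 1" "4 * D * (l * P) \<le> 1"
    using D P by (auto simp: l_def field_simps add_pos_nonneg)
  have p2: "wbound tdeg r2 P p"
    using r2 by (intro wbound_mono[OF p(1)]) (auto simp: r2_def)
  have "wbound tdeg (l * r2) (l * P) p"
    using p2 by (rule wbound_scale) (use l r2 p(2) tdeg_eq_0_iff in \<open>auto simp: tdeg_eq_0_iff\<close>)
  moreover have lr: "l * r2 \<le> r" "l * r2 \<le> r1" "0 < l * r2"
    using l r2 mult_right_le_one_le[of r2 l] by (auto simp: r2_def mult.commute)
  moreover have "wbound tdeg (l * r2) A a" "\<And>k. wbound tdeg (l * r2) (B * D ^ k) (tx (f k))"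
    using lr by (auto intro: wbound_mono[OF a] wbound_mono[OF b])
  ultimately have "wbound tdeg (l * r2) (2 * B * (2 * D * A) ^ i) (affine_subst fst a p (\<lambda>k. tx (f k)) i)" for i
    using p(2) l D additive_degree_fst additive_degree_tdeg by (intro affine_subst_wbound) auto
  moreover have "2 * D * A \<ge> 0" using D P by simp
  ultimately show ?thesis
    unfolding conv_ytx_iff_wbound tx_coef using lr(3) by blast
qed

text \<open>The substituted series is \<open>a * Y + p\<close> with \<open>Y = s t\<close>.
  Expanding in powers of \<open>Y\<close>, the factor \<open>Y ^ i\<close> contributes
  \<open>s ^ i\<close> and shifts the exponent of \<open>t\<close> by \<open>i\<close>, hence the
  index \<open>m - i\<close>.\<close>

lemma subst_y_affine:
  fixes f :: "nat \<Rightarrow> nat \<Rightarrow> ('n::finite \<Rightarrow> nat) \<Rightarrow> complex"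
  assumes p: "\<And>c. fst c = 0 \<Longrightarrow> coef p c = 0"
    and g: "tx g = fmonom (1, 0) s * a + p"
  shows "subst_y f g m \<beta> =
    (\<Sum>i\<le>m. coef (affine_subst fst a p (\<lambda>k. tx (f k)) i) (m - i, \<beta>) * s ^ i)"
proof -
  have monom_power: "(fmonom (1, 0) s :: (nat \<times> ('n \<Rightarrow> nat)) fser) ^ i = fmonom (i, 0) (s ^ i)" for i
    using fmonom_0_1[where 'a = "nat \<times> ('n \<Rightarrow> nat)"]
    by (induction i) (auto simp: fmonom_mult zero_prod_def zero_fun_def plus_fun_def)
  have coef_monom: "coef (fmonom (i, 0) k * u) (m, \<beta>) = (if i \<le> m then k * coef u (m - i, \<beta>) else 0)"
    for i k and u :: "(nat \<times> ('n \<Rightarrow> nat)) fser"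
  proof -
    have "coef (fmonom (i, 0) k * u) (m, \<beta>)
        = (\<Sum>q\<in>{(x, y). x + y = (m, \<beta>)}. if q = ((i, 0), (m - i, \<beta>)) then k * coef u (m - i, \<beta>) else 0)"
      unfolding coef_mult by (intro sum.cong) (auto simp: coef_fmonom split: if_splits)
    also have "\<dots> = (if i \<le> m then k * coef u (m - i, \<beta>) else 0)"
      by (subst sum.delta) (auto simp: finite_decompositions)
    finally show ?thesis .
  qed
  let ?T = "\<lambda>i k. of_nat (k choose i) * tx (f k) * a ^ i * p ^ (k - i)"
  have "(\<Sum>k\<le>m. tx (f k) * tx g ^ k) = (\<Sum>k\<le>m. \<Sum>i\<le>k. fmonom (i, 0) (s ^ i) * ?T i k)"
    unfolding g binomial_ring sum_distrib_left
    by (simp add: power_mult_distrib monom_power[unfolded One_nat_def] mult_ac)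
  also have "\<dots> = (\<Sum>k\<le>m. \<Sum>i\<le>m. fmonom (i, 0) (s ^ i) * ?T i k)"
    by (intro sum.cong[OF refl] sum.mono_neutral_left) (auto simp: not_le binomial_eq_0)
  also have "\<dots> = (\<Sum>i\<le>m. fmonom (i, 0) (s ^ i) * (\<Sum>k\<le>m. ?T i k))"
    by (subst sum.swap) (simp add: sum_distrib_left)
  finally have "subst_y f g m \<beta> = (\<Sum>i\<le>m. coef (fmonom (i, 0) (s ^ i) * (\<Sum>k\<le>m. ?T i k)) (m, \<beta>))"
    by (simp only: subst_y_eq coef_sum)
  also have "\<dots> = (\<Sum>i\<le>m. coef (affine_subst fst a p (\<lambda>k. tx (f k)) i) (m - i, \<beta>) * s ^ i)"
  proof (rule sum.cong[OF refl], goal_cases)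
    case (1 i)
    then have "coef (affine_subst fst a p (\<lambda>k. tx (f k)) i) (m - i, \<beta>) = coef (\<Sum>k\<le>m. ?T i k) (m - i, \<beta>)"
      by (intro coef_affine_subst[OF additive_degree_fst p]) auto
    then show ?case using 1 by (simp add: coef_monom mult.commute del: coef_sum)
  qed
  finally show ?thesis .
qed

text \<open>\<open>T\<close> is the substitution of \<open>a y + p\<close> for \<open>y\<close>,
  where \<open>a\<close> is \<open>b 1\<close> and \<open>p\<close> collects the terms of order at
  least 2 in \<open>t\<close>, so that \<open>phi_s b s\<close> is \<open>s t a + p\<close>. It is
  invertible because \<open>a\<close> has constant term 1.\<close>

lemma straighten:
  fixes b :: "nat \<Rightarrow> ('n::finite \<Rightarrow> nat) \<Rightarrow> complex"
  assumes phi_conv: "conv_tx (phi b)" and b10: "b 1 (\<lambda>_. 0) = 1"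
  obtains T :: "(nat \<Rightarrow> nat \<Rightarrow> ('n \<Rightarrow> nat) \<Rightarrow> complex) \<Rightarrow> nat \<Rightarrow> nat \<Rightarrow> ('n \<Rightarrow> nat) \<Rightarrow> complex"
  where "surj T" "\<And>f. conv_ytx (T f) \<longleftrightarrow> conv_ytx f"
    "\<And>f s m \<beta>. subst_y f (phi_s b s) m \<beta> = (\<Sum>i\<le>m. T f i (m - i) \<beta> * s ^ i)"
proof -
  define a where "a = tx (\<lambda>m \<beta>. if m = 0 then b 1 \<beta> else 0)"
  define p where "p = tx (\<lambda>m \<beta>. if m < 2 then 0 else b m \<beta>)"
  obtain r B where r: "r > 0" and B: "wbound tdeg r B (tx (phi b))"
    using conv_tx_imp_wbound[OF phi_conv] by blast
  have pb: "wbound tdeg r B p"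
    unfolding wbound_def
  proof clarify
    fix F :: "(nat \<times> ('n \<Rightarrow> nat)) set" assume "finite F"
    have "(\<Sum>c\<in>F. cmod (coef p c) * r ^ tdeg c) \<le> (\<Sum>c\<in>F. cmod (coef (tx (phi b)) c) * r ^ tdeg c)"
      using r by (intro sum_mono mult_right_mono) (auto simp: p_def phi_def)
    also have "\<dots> \<le> B" using B \<open>finite F\<close> by (rule wboundD)
    finally show "(\<Sum>c\<in>F. cmod (coef p c) * r ^ tdeg c) \<le> B" .
  qed
  \<comment> \<open>The coefficients of \<open>a\<close> are those of \<open>t\<close> in
    \<open>phi b\<close>. Their total degree drops by one, which costs a factor
    \<open>1 / r\<close>.\<close>
  have ab: "wbound tdeg r (B / r) a"
    unfolding wbound_def
  proof clarify
    fix F :: "(nat \<times> ('n \<Rightarrow> nat)) set" assume F: "finite F"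
    let ?F = "{c \<in> F. fst c = 0}"
    have "(\<Sum>c\<in>F. cmod (coef a c) * r ^ tdeg c) = (\<Sum>c\<in>?F. cmod (coef a c) * r ^ tdeg c)"
      using F by (intro sum.mono_neutral_right) (auto simp: a_def)
    also have "\<dots> = (\<Sum>c\<in>?F. cmod (coef (tx (phi b)) (1, snd c)) * r ^ tdeg (1, snd c) / r)"
      using r by (intro sum.cong) (auto simp: a_def phi_def tdeg_def)
    also have "\<dots> = (\<Sum>c\<in>(\<lambda>c. (1, snd c)) ` ?F. cmod (coef (tx (phi b)) c) * r ^ tdeg c) / r"
      by (subst sum.reindex) (auto simp: inj_on_def sum_divide_distrib)
    also have "\<dots> \<le> B / r"
      using r F by (intro divide_right_mono wboundD[OF B]) auto
    finally show "(\<Sum>c\<in>F. cmod (coef a c) * r ^ tdeg c) \<le> B / r" .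
  qed
  have a0: "coef a 0 = 1" using b10 by (simp add: a_def zero_prod_def zero_fun_def)
  have p0: "coef p c = 0" if "fst c = 0" for c using that by (cases c) (simp add: p_def)
  obtain a' r' where r': "r' > 0" and aa': "a * a' = 1" and a'b: "wbound tdeg r' 2 a'"
    using inverse_fser_exists[OF additive_degree_tdeg _ a0 ab r] tdeg_eq_0_iff by blast
  \<comment> \<open>Solving \<open>y = a Y + p\<close> gives \<open>Y = a' y + q\<close>. Like
    \<open>p\<close>, the series \<open>q\<close> has no terms of order 0 in \<open>t\<close>, so it
    may be substituted.\<close>
  define q where "q = - (a' * p)"
  have q0: "coef q c = 0" if "fst c = 0" for c
    using coef_mult_eq_0[OF additive_degree_fst, of c 0 1 a' p] that p0 by (simp add: q_def)
  define r2 where "r2 = min r r'"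
  have r2: "r2 > 0" "r2 \<le> r" "r2 \<le> r'" using r r' by (auto simp: r2_def)
  have qb: "wbound tdeg r2 (2 * B) q"
    unfolding q_def using r2 a'b pb
    by (intro wbound_minus wbound_mult additive_degree_tdeg) (auto intro: wbound_mono)
  have a'b2: "wbound tdeg r2 2 a'" using a'b r2 by (auto intro: wbound_mono)
  have pq: "a * q + p = 0" "a' * p + q = 0"
    using aa' by (auto simp: q_def mult.assoc[symmetric])
  define T where "T = (\<lambda>f k m \<beta>. coef (affine_subst fst a p (\<lambda>k. tx (f k)) k) (m, \<beta>))"
  define T' where "T' = (\<lambda>f k m \<beta>. coef (affine_subst fst a' q (\<lambda>k. tx (f k)) k) (m, \<beta>))"
  have T'T: "T' (T f) = f" for f
    unfolding T_def T'_def tx_coef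
    using affine_subst_inverse[OF additive_degree_fst p0 q0 aa' pq(1), where f = "\<lambda>k. tx (f k)"] by (simp add: fun_eq_iff)
  have TT': "T (T' f) = f" for f
    unfolding T_def T'_def tx_coef
    using affine_subst_inverse[OF additive_degree_fst q0 p0 _ pq(2), where f = "\<lambda>k. tx (f k)"] aa'
    by (simp add: fun_eq_iff mult.commute)
  have conv_T: "conv_ytx (T f)" if "conv_ytx f" for f
    unfolding T_def using affine_subst_conv_ytx[OF that r ab pb p0] .
  have conv_T': "conv_ytx (T' f)" if "conv_ytx f" for f
    unfolding T'_def using affine_subst_conv_ytx[OF that r2(1) a'b2 qb q0] .
  have txphi: "tx (phi_s b s) = fmonom (1, 0) s * a + p" for s
  proof (rule fser_eqI, clarify)
    fix m :: nat and \<beta> :: "'n \<Rightarrow> nat"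
    have "coef (fmonom (1, 0) s * a) (m, \<beta>)
        = (\<Sum>q\<in>{(x, y). x + y = (m, \<beta>)}. if q = ((1, 0), (m - 1, \<beta>)) then s * coef a (m - 1, \<beta>) else 0)"
      unfolding coef_mult by (intro sum.cong) (auto simp: coef_fmonom split: if_splits)
    also have "\<dots> = (if 1 \<le> m then s * coef a (m - 1, \<beta>) else 0)"
      by (subst sum.delta) (auto simp: finite_decompositions)
    finally show "coef (tx (phi_s b s)) (m, \<beta>) = coef (fmonom (1, 0) s * a + p) (m, \<beta>)"
      by (auto simp: a_def p_def phi_s_def)
  qed
  show thesis
  proof (rule that)
    show "surj T" using TT' by (metis surjI)
    show "conv_ytx (T f) \<longleftrightarrow> conv_ytx f" for f
      using conv_T conv_T' T'T by metis
    show "subst_y f (phi_s b s) m \<beta> = (\<Sum>i\<le>m. T f i (m - i) \<beta> * s ^ i)" for f s m \<beta>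
      unfolding T_def by (rule subst_y_affine[OF p0 txphi])
  qed
qed

section \<open>Transfinite diameter and Chebyshev polynomials\<close>

text \<open>The product over ordered pairs is the square of the Vandermonde product, so
  \<open>diam_k k K ^ (k * (k - 1))\<close> is the supremum of \<open>discr\<close> over the
  \<open>k\<close>-point subsets, when these exist. Sets make it easy to remove a point.\<close>

definition discr :: "complex set \<Rightarrow> real" where
  "discr S = (\<Prod>x\<in>S. \<Prod>y\<in>S - {x}. cmod (x - y))"

lemma discr_nonneg: "0 \<le> discr S"
  by (simp add: discr_def prod_nonneg)

lemma discr_insert:
  assumes "finite S" "x \<notin> S"
  shows "discr (insert x S) = discr S * (\<Prod>y\<in>S. cmod (x - y))\<^sup>2"
proof -
  have "(\<Prod>v\<in>insert x S - {u}. cmod (u - v)) = cmod (x - u) * (\<Prod>v\<in>S - {u}. cmod (u - v))"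
    if "u \<in> S" for u
  proof -
    have "insert x S - {u} = insert x (S - {u})" using that assms by auto
    then show ?thesis using assms that by (simp add: norm_minus_commute)
  qed
  then have "(\<Prod>u\<in>S. \<Prod>v\<in>insert x S - {u}. cmod (u - v))
      = (\<Prod>u\<in>S. cmod (x - u)) * discr S"
    unfolding discr_def by (simp flip: prod.distrib)
  moreover have "insert x S - {x} = S" using assms by auto
  ultimately show ?thesis
    using assms by (simp add: discr_def power2_eq_square)
qed

lemma discr_le_power:
  assumes "finite S" "\<And>x y. x \<in> S \<Longrightarrow> y \<in> S \<Longrightarrow> cmod (x - y) \<le> D"
  shows "discr S \<le> D ^ (card S * (card S - 1))"
proof -
  have "discr S \<le> (\<Prod>x\<in>S. \<Prod>y\<in>S - {x}. D)"
    unfolding discr_def using assms by (intro prod_mono conjI prod_nonneg) auto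
  also have "\<dots> = (\<Prod>x\<in>S. D ^ (card S - 1))"
    using assms by (intro prod.cong) auto
  also have "\<dots> = D ^ (card S * (card S - 1))"
    by (simp add: power_mult[symmetric] mult.commute)
  finally show ?thesis .
qed

lemma vandermonde_Suc:
  fixes z :: "nat \<Rightarrow> complex"
  shows "(\<Prod>(i,j)\<in>{(i,j). i < j \<and> j < Suc k}. cmod (z i - z j))
      = (\<Prod>(i,j)\<in>{(i,j). i < j \<and> j < k}. cmod (z i - z j)) * (\<Prod>i<k. cmod (z k - z i))"
proof -
  have eq: "{(i,j). i < j \<and> j < Suc k} = {(i,j). i < j \<and> j < k} \<union> (\<lambda>i. (i, k)) ` {..<k}"
    by (auto simp: image_iff)
  have fin: "finite {(i,j). i < j \<and> j < k}"
    by (rule finite_subset[of _ "{..<k} \<times> {..<k}"]) auto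
  have "(\<Prod>(i,j)\<in>(\<lambda>i. (i, k)) ` {..<k}. cmod (z i - z j)) = (\<Prod>i<k. cmod (z k - z i))"
    by (subst prod.reindex) (auto simp: inj_on_def norm_minus_commute)
  moreover have "(\<Prod>(i,j)\<in>{(i,j). i < j \<and> j < Suc k}. cmod (z i - z j))
      = (\<Prod>(i,j)\<in>{(i,j). i < j \<and> j < k}. cmod (z i - z j)) * (\<Prod>(i,j)\<in>(\<lambda>i. (i, k)) ` {..<k}. cmod (z i - z j))"
    unfolding eq using fin by (intro prod.union_disjoint) auto
  ultimately show ?thesis by simp
qed

lemma vandermonde_square:
  fixes z :: "nat \<Rightarrow> complex"
  assumes "inj_on z {..<k}"
  shows "(\<Prod>(i,j)\<in>{(i,j). i < j \<and> j < k}. cmod (z i - z j))\<^sup>2 = discr (z ` {..<k})"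
  using assms
proof (induction k)
  case (Suc k)
  have inj: "inj_on z {..<k}" "z k \<notin> z ` {..<k}"
    using Suc.prems by (auto simp: lessThan_Suc)
  have "discr (z ` {..<Suc k}) = discr (z ` {..<k}) * (\<Prod>y\<in>z ` {..<k}. cmod (z k - y))\<^sup>2"
    using inj by (simp add: lessThan_Suc discr_insert)
  also have "(\<Prod>y\<in>z ` {..<k}. cmod (z k - y)) = (\<Prod>i<k. cmod (z k - z i))"
    using inj by (simp add: prod.reindex)
  finally show ?case
    unfolding vandermonde_Suc using Suc.IH[OF inj(1)] by (simp add: power_mult_distrib)
qed (simp add: discr_def)

lemma vandermonde_eq_0:
  fixes z :: "nat \<Rightarrow> complex"
  assumes "\<not> inj_on z {..<k}"
  shows "(\<Prod>(i,j)\<in>{(i,j). i < j \<and> j < k}. cmod (z i - z j)) = 0"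
proof -
  obtain i j where "i < k" "j < k" "i \<noteq> j" "z i = z j"
    using assms by (auto simp: inj_on_def)
  then have "\<exists>i j. i < j \<and> j < k \<and> z i = z j" by (metis nat_neq_iff)
  then obtain i j where "i < j" "j < k" "z i = z j" by blast
  moreover have "finite {(i,j). i < j \<and> j < k}"
    by (rule finite_subset[of _ "{..<k} \<times> {..<k}"]) auto
  ultimately show ?thesis by (intro prod_zero) auto
qed

lemma powr_pair_root_power:
  fixes v :: real
  assumes "k \<ge> 2" "v \<ge> 0"
  shows "(v powr (2 / (real k * (real k - 1)))) ^ (k * (k - 1)) = v\<^sup>2"
proof (cases "v = 0")
  case True
  then show ?thesis using assms by simp
next
  case False
  have "real k * (real k - 1) = real (k * (k - 1))" "k * (k - 1) > 0"
    using assms by (auto simp: of_nat_diff)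
  moreover have "(v powr (2 / real n)) ^ n = v\<^sup>2" if "n > 0" for n
  proof -
    have "(v powr (2 / real n)) ^ n = (v powr (2 / real n)) powr real n"
      using False by (simp add: powr_realpow)
    also have "\<dots> = v powr 2" using that by (simp add: powr_powr)
    finally show ?thesis using False assms by simp
  qed
  ultimately show ?thesis by metis
qed

text \<open>Replaces the supremum of real powers over tuples by inequalities between natural powers
  over \<open>k\<close>-point subsets; tuples with a repetition have product 0.\<close>

lemma diam_k_le_iff:
  assumes K: "bounded K" "K \<noteq> {}" and k: "k \<ge> 2" and e: "0 \<le> e"
  shows "diam_k k K \<le> e \<longleftrightarrow> (\<forall>S\<subseteq>K. finite S \<and> card S = k \<longrightarrow> discr S \<le> e ^ (k * (k - 1)))"
proof -
  define V where "V = (\<lambda>z :: nat \<Rightarrow> complex. (\<Prod>(i,j)\<in>{(i,j). i < j \<and> j < k}. cmod (z i - z j)))"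
  have V0: "V z \<ge> 0" for z by (auto simp: V_def intro!: prod_nonneg)
  have n0: "k * (k - 1) > 0" using k by simp
  have le: "V z powr (2 / (real k * (real k - 1))) \<le> e \<longleftrightarrow> (V z)\<^sup>2 \<le> e ^ (k * (k - 1))" if "e \<ge> 0" for z e
    using power_mono_iff[of "V z powr (2 / (real k * (real k - 1)))" e "k * (k - 1)"] n0 that
    unfolding powr_pair_root_power[OF k V0] by simp
  have all: "(\<forall>z. (\<forall>i<k. z i \<in> K) \<longrightarrow> V z powr (2 / (real k * (real k - 1))) \<le> e)
      \<longleftrightarrow> (\<forall>S\<subseteq>K. finite S \<and> card S = k \<longrightarrow> discr S \<le> e ^ (k * (k - 1)))" (is "?L \<longleftrightarrow> ?R") if e: "e \<ge> 0" for e
  proof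
    assume L: ?L
    show ?R
    proof clarify
      fix S assume S: "S \<subseteq> K" "finite S" "k = card S"
      obtain z where z: "bij_betw z {..<k} S"
        using S ex_bij_betw_nat_finite[of S] by (auto simp: atLeast0LessThan)
      then have "\<forall>i<k. z i \<in> K" using S by (auto simp: bij_betw_def)
      then have "(V z)\<^sup>2 \<le> e ^ (k * (k - 1))" using L le[OF e] by blast
      moreover have "(V z)\<^sup>2 = discr S"
        using vandermonde_square[of z k] z by (simp add: V_def bij_betw_def)
      ultimately show "discr S \<le> e ^ (card S * (card S - 1))" using S by simp
    qed
  next
    assume R: ?R
    show ?L
    proof (intro allI impI)
      fix z assume z: "\<forall>i<k. z i \<in> K"
      have "(V z)\<^sup>2 \<le> e ^ (k * (k - 1))"
      proof (cases "inj_on z {..<k}")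
        case True
        then have "(V z)\<^sup>2 = discr (z ` {..<k})" by (simp add: V_def vandermonde_square)
        moreover have "card (z ` {..<k}) = k" using True by (simp add: card_image)
        ultimately show ?thesis using R z by (metis finite_imageI finite_lessThan image_subset_iff lessThan_iff)
      next
        case False
        then show ?thesis using e by (simp add: V_def vandermonde_eq_0)
      qed
      then show "V z powr (2 / (real k * (real k - 1))) \<le> e" using le[OF e] by simp
    qed
  qed
  obtain R where R: "\<And>x. x \<in> K \<Longrightarrow> cmod x \<le> R" using K(1) by (auto simp: bounded_iff)
  have "discr S \<le> (2 * \<bar>R\<bar>) ^ (k * (k - 1))" if "S \<subseteq> K" "finite S" "card S = k" for S
  proof -
    have "cmod (x - y) \<le> 2 * \<bar>R\<bar>" if "x \<in> S" "y \<in> S" for x y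
      using R[of x] R[of y] that \<open>S \<subseteq> K\<close> norm_triangle_ineq4[of x y] by force
    then show ?thesis using discr_le_power[OF that(2)] that(3) by blast
  qed
  then have bdd: "\<forall>z. (\<forall>i<k. z i \<in> K) \<longrightarrow> V z powr (2 / (real k * (real k - 1))) \<le> 2 * \<bar>R\<bar>"
    by (subst all) auto
  define X where "X = {V z powr (2 / (real k * (real k - 1))) | z. \<forall>i<k. z i \<in> K}"
  have "X \<noteq> {}" using K(2) by (auto simp: X_def)
  moreover have "bdd_above X" using bdd by (auto simp: X_def bdd_above_def)
  ultimately have "Sup X \<le> e \<longleftrightarrow> (\<forall>x\<in>X. x \<le> e)" by (rule cSup_le_iff)
  moreover have "diam_k k K = Sup X" using K(2) by (simp add: diam_k_def X_def V_def)
  ultimately have "diam_k k K \<le> e \<longleftrightarrow> (\<forall>z. (\<forall>i<k. z i \<in> K) \<longrightarrow> V z powr (2 / (real k * (real k - 1))) \<le> e)"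
    by (auto simp: X_def)
  then show ?thesis using all[OF e] by simp
qed

lemma diam_k_nonneg: "bounded K \<Longrightarrow> k \<ge> 2 \<Longrightarrow> 0 \<le> diam_k k K"
proof (cases "K = {}")
  case False
  assume K: "bounded K" and k: "k \<ge> 2"
  obtain x where x: "x \<in> K" using False by blast
  show ?thesis
  proof (rule ccontr)
    assume neg: "\<not> ?thesis"
    let ?f = "\<lambda>z. (\<Prod>(i,j)\<in>{(i,j). i < j \<and> j < k}. cmod (z i - z j)) powr (2 / (real k * (real k - 1)))"
    obtain R where R: "\<And>x. x \<in> K \<Longrightarrow> cmod x \<le> R" using K by (auto simp: bounded_iff)
    have "bdd_above {?f z | z. \<forall>i<k. z i \<in> K}"
    proof (rule bdd_aboveI)
      fix y assume "y \<in> {?f z | z. \<forall>i<k. z i \<in> K}"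
      then obtain z where z: "y = ?f z" "\<forall>i<k. z i \<in> K" by blast
      have "(\<Prod>(i,j)\<in>{(i,j). i < j \<and> j < k}. cmod (z i - z j)) \<le> (\<Prod>(i,j)\<in>{(i,j). i < j \<and> j < k}. 2 * \<bar>R\<bar>)"
      proof (rule prod_mono, clarify)
        fix i j :: nat assume ij: "i < j" "j < k"
        show "0 \<le> cmod (z i - z j) \<and> cmod (z i - z j) \<le> 2 * \<bar>R\<bar>"
          using R[of "z i"] R[of "z j"] z(2) ij norm_triangle_ineq4[of "z i" "z j"] by force
      qed
      then show "y \<le> (\<Prod>(i,j)\<in>{(i,j). i < j \<and> j < k}. 2 * \<bar>R\<bar>) powr (2 / (real k * (real k - 1)))"
        unfolding z(1) using k by (intro powr_mono2) (auto intro!: prod_nonneg)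
    qed
    moreover have "?f (\<lambda>_. x) \<in> {?f z | z. \<forall>i<k. z i \<in> K}"
      by (intro CollectI exI[of _ "\<lambda>_. x"]) (use x in auto)
    ultimately have "?f (\<lambda>_. x) \<le> diam_k k K"
      using False by (simp add: diam_k_def cSup_upper)
    moreover have "?f (\<lambda>_. x) \<ge> 0" by simp
    ultimately show False using neg by linarith
  qed
qed (simp add: diam_k_def)

text \<open>Fekete's argument: from \<open>Suc k\<close> points remove the one with the least
  product of distances to the others, and compare the discriminants.\<close>

lemma diam_k_Suc_le:
  assumes K: "bounded K" "K \<noteq> {}" and k: "k \<ge> 2"
  shows "diam_k (Suc k) K \<le> diam_k k K"
proof -
  define e where "e = diam_k k K"
  have e: "e \<ge> 0" using diam_k_nonneg K k by (simp add: e_def)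
  have bd: "discr S \<le> e ^ (k * (k - 1))" if "S \<subseteq> K" "finite S" "card S = k" for S
    using diam_k_le_iff[OF K k e] that by (simp add: e_def)
  have "discr S \<le> e ^ (Suc k * (Suc k - 1))" if S: "S \<subseteq> K" "finite S" "card S = Suc k" for S
  proof (cases "discr S = 0")
    case False
    then have pos: "discr S > 0" using discr_nonneg[of S] by simp
    define w where "w = (\<lambda>x. \<Prod>y\<in>S - {x}. cmod (x - y))"
    have w0: "w x \<ge> 0" for x by (auto simp: w_def intro: prod_nonneg)
    have "S \<noteq> {}" using S by auto
    then obtain l where l: "l \<in> S" "\<And>x. x \<in> S \<Longrightarrow> w l \<le> w x"
      using S(2) by (metis (no_types, lifting) arg_min_if_finite(1) arg_min_least)
    \<comment> \<open>\<open>discr S\<close> is the product of all the \<open>w x\<close>, so the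
      least of them is at most its geometric mean.\<close>
    have "w l ^ Suc k = (\<Prod>x\<in>S. w l)" by (simp only: prod_constant S)
    also have "\<dots> \<le> (\<Prod>x\<in>S. w x)" using l w0 by (intro prod_mono) auto
    also have "\<dots> = discr S" by (simp add: discr_def w_def)
    finally have wl: "w l ^ Suc k \<le> discr S" .
    define S' where "S' = S - {l}"
    have S': "S = insert l S'" "l \<notin> S'" "finite S'" "card S' = k" "S' \<subseteq> K"
      using l S by (auto simp: S'_def)
    have "discr S = discr S' * (w l)\<^sup>2"
      using discr_insert[OF S'(3,2)] unfolding S'(1)[symmetric] w_def S'_def[symmetric] .
    then have "discr S ^ Suc k = discr S' ^ Suc k * (w l ^ Suc k)\<^sup>2"
      by (simp only: power_mult_distrib power_mult[symmetric] mult.commute)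
    also have "\<dots> \<le> discr S' ^ Suc k * (discr S)\<^sup>2"
      using wl w0 discr_nonneg by (intro mult_left_mono power_mono) auto
    finally have "discr S ^ (k - 1) * (discr S)\<^sup>2 \<le> discr S' ^ Suc k * (discr S)\<^sup>2"
      using k by (simp flip: power_add)
    then have "discr S ^ (k - 1) \<le> discr S' ^ Suc k" using pos by simp
    also have "\<dots> \<le> (e ^ (k * (k - 1))) ^ Suc k"
      using bd[of S'] S' discr_nonneg by (intro power_mono) auto
    also have "\<dots> = (e ^ (Suc k * (Suc k - 1))) ^ (k - 1)"
      by (simp only: power_mult[symmetric] diff_Suc_1 mult_ac)
    finally show ?thesis
      using k e discr_nonneg by (subst (asm) power_mono_iff) auto
  qed (use e in simp)
  then show ?thesis
    using diam_k_le_iff[OF K, of "Suc k" e] k e by (auto simp: e_def)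
qed

lemma diam_k_LIMSEQ:
  assumes "bounded K"
  shows "(\<lambda>k. diam_k k K) \<longlonglongrightarrow> transfinite_diameter K"
proof -
  have "convergent (\<lambda>k. diam_k k K)"
  proof (cases "K = {}")
    case True
    then show ?thesis by (simp add: diam_k_def convergent_const)
  next
    case False
    \<comment> \<open>Monotonicity starts at 2; for smaller \<open>k\<close> the exponent in
      \<open>diam_k\<close> has denominator zero.\<close>
    have "decseq (\<lambda>k. diam_k (k + 2) K)"
      using diam_k_Suc_le[OF assms False] by (intro decseq_SucI) auto
    moreover have "\<forall>k. 0 \<le> diam_k (k + 2) K" using diam_k_nonneg[OF assms] by simp
    ultimately obtain L where "(\<lambda>k. diam_k (k + 2) K) \<longlonglongrightarrow> L"
      by (rule decseq_convergent)
    then show ?thesis using LIMSEQ_offset[of "\<lambda>k. diam_k k K" 2 L] unfolding convergent_def by blast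
  qed
  then show ?thesis by (simp add: transfinite_diameter_def convergent_LIMSEQ_iff)
qed

lemma transfinite_diameter_nonneg:
  assumes "bounded K"
  shows "0 \<le> transfinite_diameter K"
  by (rule LIMSEQ_le_const[OF diam_k_LIMSEQ[OF assms]]) (use diam_k_nonneg[OF assms] in auto)

lemma transfinite_diameter_le:
  assumes "\<And>x. x \<in> K \<Longrightarrow> cmod x \<le> r" "0 \<le> r"
  shows "transfinite_diameter K \<le> 2 * r"
proof -
  have b: "bounded K" using assms by (auto simp: bounded_iff)
  have "diam_k k K \<le> 2 * r" if "k \<ge> 2" for k
  proof (cases "K = {}")
    case False
    have "discr S \<le> (2 * r) ^ (k * (k - 1))" if "S \<subseteq> K" "finite S" "card S = k" for S
    proof -
      have "cmod (x - y) \<le> 2 * r" if "x \<in> S" "y \<in> S" for x y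
        using assms(1)[of x] assms(1)[of y] that \<open>S \<subseteq> K\<close> norm_triangle_ineq4[of x y] by force
      then show ?thesis using discr_le_power[OF that(2)] that(3) by blast
    qed
    then show ?thesis using assms \<open>k \<ge> 2\<close> by (subst diam_k_le_iff[OF b False]) auto
  qed (use assms in \<open>simp add: diam_k_def\<close>)
  then show ?thesis by (intro LIMSEQ_le_const2[OF diam_k_LIMSEQ[OF b]]) auto
qed

lemma zero_capacity_imp:
  assumes "zero_capacity E" "compact K" "K \<subseteq> E"
  shows "transfinite_diameter K = 0"
proof -
  obtain r where r: "\<And>x. x \<in> K \<Longrightarrow> cmod x \<le> r" "r > 0"
    using assms(2) compact_imp_bounded bounded_pos by metis
  define X where "X = {transfinite_diameter K | K. compact K \<and> K \<subseteq> E \<inter> {z. cmod z \<le> r}}"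
  have "bdd_above X"
    using transfinite_diameter_le[of _ r] r(2) by (intro bdd_aboveI[of _ "2 * r"]) (auto simp: X_def)
  moreover have "transfinite_diameter K \<in> X" using assms r by (auto simp: X_def)
  ultimately have "transfinite_diameter K \<le> Sup X" by (simp add: cSup_upper)
  also have "Sup X = 0" using assms(1) r(2) by (auto simp: zero_capacity_def capacity_def X_def)
  finally show ?thesis using transfinite_diameter_nonneg compact_imp_bounded assms(2) by force
qed

lemma zero_capacityI:
  assumes "\<And>K. compact K \<Longrightarrow> K \<subseteq> E \<Longrightarrow> transfinite_diameter K = 0"
  shows "zero_capacity E"
  unfolding zero_capacity_def capacity_def
proof clarify
  fix r :: real
  \<comment> \<open>The empty compact set keeps this set of values nonempty.\<close>
  have "{transfinite_diameter K | K. compact K \<and> K \<subseteq> E \<inter> {z. cmod z \<le> r}} = {0}"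
    using assms by (auto intro!: exI[of _ "{}"])
  then show "Sup {transfinite_diameter K | K. compact K \<and> K \<subseteq> E \<inter> {z. cmod z \<le> r}} = 0" by simp
qed

section \<open>Chebyshev-null sets and Leja sequences\<close>

text \<open>For nonempty sets: the Chebyshev constant formed with zeros in \<open>S\<close>
  vanishes. Zeros in \<open>S\<close> give control away from \<open>S\<close> too, from above by the
  diameter of a larger set and from below by the distance to \<open>S\<close>. For
  \<open>k > 0\<close> no zeros can be chosen in the empty set, which therefore fails the condition
  and is treated apart.\<close>

definition cheb_null :: "complex set \<Rightarrow> bool" where
  "cheb_null S \<longleftrightarrow> (\<forall>\<epsilon>>0. \<exists>k>0. \<exists>z :: nat \<Rightarrow> complex. (\<forall>i<k. z i \<in> S) \<and>
     (\<forall>s\<in>S. (\<Prod>i<k. cmod (s - z i)) \<le> \<epsilon> ^ k))"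

text \<open>A sequence of Leja type: each point maximises, up to a factor 2, the product of the distances
  to its predecessors.\<close>

lemma leja_sequence:
  assumes S: "bounded S" "S \<noteq> {}" "\<not> cheb_null S"
  obtains c z where "c > 0" "\<And>j. z j \<in> S" "\<And>j. c ^ j \<le> (\<Prod>i<j. cmod (z j - z i))"
    "\<And>j s. s \<in> S \<Longrightarrow> (\<Prod>i<j. cmod (s - z i)) \<le> 2 * (\<Prod>i<j. cmod (z j - z i))"
proof -
  obtain c where c: "c > 0"
    and n: "\<not> (\<exists>k>0. \<exists>z. (\<forall>i<k. z i \<in> S) \<and> (\<forall>s\<in>S. (\<Prod>i<k. cmod (s - z i)) \<le> c ^ k))"
    using S(3) unfolding cheb_null_def by blast
  have big: "\<exists>s\<in>S. (\<Prod>i<k. cmod (s - z i)) > c ^ k" if "k > 0" "\<forall>i<k. z i \<in> S" for k z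
  proof (rule ccontr)
    assume "\<not> ?thesis"
    then have "\<forall>s\<in>S. (\<Prod>i<k. cmod (s - z i)) \<le> c ^ k" by (simp add: not_less)
    then show False using n that by blast
  qed
  obtain R where R: "\<And>x. x \<in> S \<Longrightarrow> cmod x \<le> R" using S(1) by (auto simp: bounded_iff)
  define P where "P = (\<lambda>z j s. s \<in> S \<and> c ^ j \<le> (\<Prod>i<j. cmod (s - z i)) \<and>
    (\<forall>s'\<in>S. (\<Prod>i<j. cmod (s' - z i)) \<le> 2 * (\<Prod>i<j. cmod (s - z i))))"
  have "\<exists>z :: nat \<Rightarrow> complex. \<forall>j. P z j (z j)"
  proof (rule dependent_wellorder_choice)
    fix s j and f g :: "nat \<Rightarrow> complex"
    assume "\<And>i. i < j \<Longrightarrow> f i = g i"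
    then have "(\<Prod>i<j. cmod (s - f i)) = (\<Prod>i<j. cmod (s - g i))" for s by (intro prod.cong) auto
    then show "P f j s = P g j s" by (simp add: P_def)
  next
    fix j and f :: "nat \<Rightarrow> complex"
    assume IH: "\<And>i. i < j \<Longrightarrow> P f i (f i)"
    show "\<exists>s. P f j s"
    proof (cases "j = 0")
      case True
      then show ?thesis using S(2) by (auto simp: P_def)
    next
      case False
      define h where "h = (\<lambda>s. \<Prod>i<j. cmod (s - f i))"
      have fS: "\<forall>i<j. f i \<in> S" using IH by (auto simp: P_def)
      obtain s0 where s0: "s0 \<in> S" "h s0 > c ^ j" using big[of j f] False fS by (auto simp: h_def)
      have "h s \<le> (\<Prod>i<j. 2 * \<bar>R\<bar>)" if "s \<in> S" for s
        unfolding h_def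
      proof (intro prod_mono conjI)
        fix i assume "i \<in> {..<j}"
        then show "cmod (s - f i) \<le> 2 * \<bar>R\<bar>"
          using R[of s] R[of "f i"] that fS norm_triangle_ineq4[of s "f i"] by force
      qed auto
      then have bdd: "bdd_above (h ` S)" by (auto simp: bdd_above_def)
      \<comment> \<open>\<open>S\<close> need not be closed, so the supremum may not be attained. It
        is positive and exceeds \<open>c ^ j\<close>, hence some value lies above both
        \<open>c ^ j\<close> and half the supremum.\<close>
      have "max (c ^ j) (Sup (h ` S) / 2) < Sup (h ` S)"
      proof -
        have "h s0 \<le> Sup (h ` S)" using s0 bdd by (intro cSup_upper) auto
        moreover have "c ^ j > 0" using c by simp
        ultimately show ?thesis using s0 by simp
      qed
      then obtain s where s: "s \<in> S" "max (c ^ j) (Sup (h ` S) / 2) < h s"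
        using less_cSupE[of _ "h ` S"] s0 by blast
      have "h s' \<le> 2 * h s" if "s' \<in> S" for s'
      proof -
        have "h s' \<le> Sup (h ` S)" using that bdd by (intro cSup_upper) auto
        then show ?thesis using s by simp
      qed
      then have "P f j s" using s by (simp add: P_def h_def)
      then show ?thesis by blast
    qed
  qed
  then obtain z where "\<And>j. P z j (z j)" by blast
  then show thesis using that[OF c, of z] by (auto simp: P_def)
qed

text \<open>Adding the next Leja point \<open>z k\<close> multiplies the discriminant by the square
  of a product that is at least \<open>c ^ k\<close>. Thus the first \<open>k\<close> points have
  discriminant at least \<open>c ^ (k * (k - 1))\<close>, and \<open>diam_k\<close> stays above
  \<open>c\<close>.\<close>

lemma transfinite_diameter_pos:
  assumes K: "bounded K" "K \<noteq> {}" "\<not> cheb_null K"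
  shows "transfinite_diameter K > 0"
proof -
  obtain c z where c: "c > 0" and z: "\<And>j. z j \<in> K" "\<And>j. c ^ j \<le> (\<Prod>i<j. cmod (z j - z i))"
    using leja_sequence[OF K] by metis
  have inj: "inj z"
  proof (rule linorder_injI)
    fix i j :: nat assume "i < j"
    show "z i \<noteq> z j"
    proof
      assume "z i = z j"
      then have "(\<Prod>i<j. cmod (z j - z i)) = 0"
        using \<open>i < j\<close> by (intro prod_zero) (auto intro!: bexI[of _ i])
      then show False using z(2)[of j] zero_less_power[OF c, of j] by linarith
    qed
  qed
  have discr_ge: "c ^ (k * (k - 1)) \<le> discr (z ` {..<k})" for k
  proof (induction k)
    case (Suc k)
    have "discr (z ` {..<Suc k}) = discr (z ` {..<k}) * (\<Prod>y\<in>z ` {..<k}. cmod (z k - y))\<^sup>2"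
      using inj by (simp add: lessThan_Suc discr_insert inj_image_mem_iff)
    also have "(\<Prod>y\<in>z ` {..<k}. cmod (z k - y)) = (\<Prod>i<k. cmod (z k - z i))"
      using inj by (simp add: prod.reindex inj_on_def)
    also have "discr (z ` {..<k}) * (\<Prod>i<k. cmod (z k - z i))\<^sup>2 \<ge> c ^ (k * (k - 1)) * (c ^ k)\<^sup>2"
      using Suc z(2)[of k] c discr_nonneg by (intro mult_mono power_mono) auto
    also have "c ^ (k * (k - 1)) * (c ^ k)\<^sup>2 = c ^ (Suc k * (Suc k - 1))"
    proof -
      have "k * (k - 1) + k * 2 = Suc k * (Suc k - 1)" by (cases k) auto
      then show ?thesis by (metis power_add power_mult)
    qed
    finally show ?case .
  qed (simp add: discr_def)
  have "diam_k k K \<ge> c" if k: "k \<ge> 2" for k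
  proof -
    have "discr (z ` {..<k}) \<le> diam_k k K ^ (k * (k - 1))"
    proof -
      have "z ` {..<k} \<subseteq> K" "card (z ` {..<k}) = k"
        using z(1) inj by (auto simp: card_image inj_on_def)
      then show ?thesis
        using diam_k_le_iff[OF K(1,2) k diam_k_nonneg[OF K(1) k]] by blast
    qed
    then have "c ^ (k * (k - 1)) \<le> diam_k k K ^ (k * (k - 1))" using discr_ge[of k] by linarith
    then show ?thesis
      using k c diam_k_nonneg[OF K(1) k] by (subst (asm) power_mono_iff) auto
  qed
  then have "c \<le> transfinite_diameter K"
    by (intro LIMSEQ_le_const[OF diam_k_LIMSEQ[OF K(1)]]) auto
  then show ?thesis using c by simp
qed

lemma newton_expansion:
  fixes w :: "nat \<Rightarrow> 'a::idom poly"
  assumes "\<And>j. degree (w j) = j" "\<And>j. lead_coeff (w j) = 1" "degree p \<le> m"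
  shows "\<exists>a. p = (\<Sum>j\<le>m. smult (a j) (w j))"
  using assms(3)
proof (induction m arbitrary: p)
  case 0
  have "w 0 = 1" using assms(1,2)[of 0] by (metis degree_0_id one_pCons)
  moreover obtain x where "p = [:x:]" using 0 by (auto elim: degree_eq_zeroE)
  ultimately show ?case by (intro exI[of _ "\<lambda>_. x"]) simp
next
  case (Suc m)
  define q where "q = p - smult (coeff p (Suc m)) (w (Suc m))"
  have "degree q \<le> m"
  proof (rule degree_le, clarify)
    fix i assume "m < i"
    show "coeff q i = 0"
    proof (cases "i = Suc m")
      case True
      then show ?thesis using assms(1,2)[of "Suc m"] by (simp add: q_def)
    next
      case False
      then have "Suc m < i" using \<open>m < i\<close> by simp
      then show ?thesis using Suc.prems assms(1)[of "Suc m"] by (simp add: q_def coeff_eq_0)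
    qed
  qed
  then obtain a where a: "q = (\<Sum>j\<le>m. smult (a j) (w j))" using Suc.IH by blast
  have "p = (\<Sum>j\<le>Suc m. smult ((a(Suc m := coeff p (Suc m))) j) (w j))"
    using a by (simp add: q_def algebra_simps)
  then show ?case by blast
qed

lemma linear_factors_prod:
  fixes z :: "'i \<Rightarrow> 'a::idom"
  assumes "finite I"
  shows "degree (\<Prod>i\<in>I. [:- z i, 1:]) = card I" "lead_coeff (\<Prod>i\<in>I. [:- z i, 1:]) = 1"
proof -
  show "degree (\<Prod>i\<in>I. [:- z i, 1:]) = card I"
    by (simp add: degree_prod_eq_sum_degree)
  show "lead_coeff (\<Prod>i\<in>I. [:- z i, 1:]) = 1"
    by (subst lead_coeff_prod) simp
qed

lemma coeff_linear_factors_le: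
  fixes z :: "nat \<Rightarrow> complex"
  assumes "\<And>i. cmod (z i) \<le> R"
  shows "cmod (coeff (\<Prod>i<j. [:- z i, 1:]) k) \<le> (1 + R) ^ j"
proof (induction j arbitrary: k)
  case 0
  show ?case by (simp add: coeff_1)
next
  case (Suc j)
  let ?w = "\<Prod>i<j. [:- z i, 1:]"
  have R: "R \<ge> 0" using assms[of 0] norm_ge_zero order_trans by blast
  have "coeff (\<Prod>i<Suc j. [:- z i, 1:]) k = (case k of 0 \<Rightarrow> 0 | Suc l \<Rightarrow> coeff ?w l) - z j * coeff ?w k"
    by (simp add: coeff_pCons mult.commute split: nat.split)
  then have "cmod (coeff (\<Prod>i<Suc j. [:- z i, 1:]) k)
      \<le> cmod (case k of 0 \<Rightarrow> 0 | Suc l \<Rightarrow> coeff ?w l) + cmod (z j) * cmod (coeff ?w k)"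
    by (metis norm_mult norm_triangle_ineq4)
  also have "\<dots> \<le> (1 + R) ^ j + R * (1 + R) ^ j"
    using Suc assms R by (intro add_mono mult_mono) (auto split: nat.split)
  finally show ?case by (simp add: algebra_simps)
qed

text \<open>A substitute for the Bernstein--Walsh inequality: the coefficients in the Newton expansion at the
  points of a Leja sequence are controlled one after the other.\<close>

lemma coeff_bound_of_not_cheb_null:
  assumes S: "bounded S" "S \<noteq> {}" "\<not> cheb_null S"
  obtains D :: real where "D \<ge> 1"
    "\<And>p m B k. degree p \<le> m \<Longrightarrow> (\<And>s. s \<in> S \<Longrightarrow> cmod (poly p s) \<le> B) \<Longrightarrow> cmod (coeff p k) \<le> B * D ^ m"
proof -
  obtain c z where c: "c > 0" and z: "\<And>j. z j \<in> S" "\<And>j. c ^ j \<le> (\<Prod>i<j. cmod (z j - z i))"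
    "\<And>j s. s \<in> S \<Longrightarrow> (\<Prod>i<j. cmod (s - z i)) \<le> 2 * (\<Prod>i<j. cmod (z j - z i))"
    using leja_sequence[OF S] by metis
  obtain R where R: "\<And>x. x \<in> S \<Longrightarrow> cmod x \<le> R" using S(1) by (auto simp: bounded_iff)
  have R0: "R \<ge> 0" using R[OF z(1)[of 0]] norm_ge_zero order_trans by blast
  define w where "w = (\<lambda>j. \<Prod>i<j. [:- z i, 1:])"
  define M where "M = (\<lambda>j. \<Prod>i<j. cmod (z j - z i))"
  have poly_w: "cmod (poly (w j) s) = (\<Prod>i<j. cmod (s - z i))" for j s
    by (simp add: w_def poly_prod prod_norm[symmetric])
  have w: "degree (w j) = j" "lead_coeff (w j) = 1" for j
    using linear_factors_prod[of "{..<j}" z] by (auto simp: w_def)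
  \<comment> \<open>Combines three losses per degree: 3 from the recursion below,
    \<open>1 / c\<close> from the lower bound on node products, and \<open>1 + R\<close> from the
    coefficients of \<open>w j\<close>. The summand 1 ensures \<open>Q \<ge> 1\<close>.\<close>
  define Q where "Q = 3 / c * (1 + R) + 1"
  have Q: "Q \<ge> 1" using c R0 by (simp add: Q_def)
  have main: "cmod (coeff p k) \<le> B * (2 * Q) ^ m"
    if p: "degree p \<le> m" and B: "\<And>s. s \<in> S \<Longrightarrow> cmod (poly p s) \<le> B" for p m B k
  proof -
    have B0: "B \<ge> 0" using B[OF z(1)[of 0]] norm_ge_zero order_trans by blast
    obtain a where a: "p = (\<Sum>j\<le>m. smult (a j) (w j))"
      using newton_expansion[of w p m, OF w p] by blast
    \<comment> \<open>At \<open>z j\<close> all \<open>w i\<close> with \<open>i > j\<close> vanish,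
      so the value determines \<open>a j\<close> from the earlier coefficients. Near-maximality of
      the Leja points bounds each earlier term by \<open>2 * (B * 3 ^ i)\<close>, and
      \<open>1 + 2 * (\<Sum>i<j. 3 ^ i) = 3 ^ j\<close> closes the induction.\<close>
    have aM: "cmod (a j) * M j \<le> B * 3 ^ j" if "j \<le> m" for j
      using that
    proof (induction j rule: less_induct)
      case (less j)
      have "poly p (z j) = (\<Sum>i\<le>m. a i * poly (w i) (z j))" by (simp add: a poly_sum)
      also have "\<dots> = (\<Sum>i\<le>j. a i * poly (w i) (z j))"
      proof (rule sum.mono_neutral_right)
        show "\<forall>i\<in>{..m} - {..j}. a i * poly (w i) (z j) = 0"
        proof
          fix i assume "i \<in> {..m} - {..j}"
          then have "cmod (poly (w i) (z j)) = 0" unfolding poly_w by (intro prod_zero) auto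
          then show "a i * poly (w i) (z j) = 0" by simp
        qed
      qed (use less in auto)
      also have "\<dots> = (\<Sum>i<j. a i * poly (w i) (z j)) + a j * poly (w j) (z j)"
        by (simp flip: lessThan_Suc_atMost)
      finally have eq: "a j * poly (w j) (z j) = poly p (z j) - (\<Sum>i<j. a i * poly (w i) (z j))"
        by simp
      have "cmod (a j) * M j = cmod (a j * poly (w j) (z j))"
        by (simp add: norm_mult poly_w M_def)
      also have "\<dots> \<le> cmod (poly p (z j)) + (\<Sum>i<j. cmod (a i * poly (w i) (z j)))"
        unfolding eq by (intro order_trans[OF norm_triangle_ineq4] add_left_mono norm_sum)
      also have "\<dots> \<le> B + (\<Sum>i<j. 2 * (B * 3 ^ i))"
      proof (intro add_mono sum_mono)
        fix i assume i: "i \<in> {..<j}"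
        have "cmod (a i * poly (w i) (z j)) \<le> cmod (a i) * (2 * M i)"
          unfolding norm_mult poly_w M_def using z by (intro mult_left_mono) auto
        also have "\<dots> \<le> 2 * (B * 3 ^ i)" using less.IH[of i] less.prems i by simp
        finally show "cmod (a i * poly (w i) (z j)) \<le> 2 * (B * 3 ^ i)" .
      qed (use B z in auto)
      also have "\<dots> = B * 3 ^ j"
      proof -
        have "(\<Sum>i<j. 2 * (B * 3 ^ i)) = B * (3 ^ j - 1)" by (induction j) (auto simp: algebra_simps)
        then show ?thesis by (simp add: algebra_simps)
      qed
      finally show ?case .
    qed
    have "cmod (coeff p k) \<le> (\<Sum>j\<le>m. cmod (a j * coeff (w j) k))"
      unfolding a coeff_sum by (simp add: norm_sum)
    also have "\<dots> \<le> (\<Sum>j\<le>m. B * Q ^ m)"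
    proof (rule sum_mono)
      fix j assume j: "j \<in> {..m}"
      have "cmod (a j) * c ^ j \<le> cmod (a j) * M j"
        using z(2)[of j] by (intro mult_left_mono) (auto simp: M_def)
      also have "\<dots> \<le> B * 3 ^ j" using aM j by simp
      finally have "cmod (a j) \<le> B * (3 / c) ^ j" using c by (simp add: field_simps power_divide)
      moreover have "cmod (coeff (w j) k) \<le> (1 + R) ^ j"
        unfolding w_def using R z(1) by (intro coeff_linear_factors_le) auto
      ultimately have "cmod (a j * coeff (w j) k) \<le> B * (3 / c) ^ j * (1 + R) ^ j"
        unfolding norm_mult using B0 c by (intro mult_mono) auto
      also have "\<dots> = B * (3 / c * (1 + R)) ^ j" by (simp only: power_mult_distrib mult.assoc)
      also have "\<dots> \<le> B * Q ^ j"
        using B0 c R0 by (intro mult_left_mono power_mono) (auto simp: Q_def)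
      also have "\<dots> \<le> B * Q ^ m"
        using B0 Q j by (intro mult_left_mono power_increasing) auto
      finally show "cmod (a j * coeff (w j) k) \<le> B * Q ^ m" .
    qed
    also have "\<dots> = real (Suc m) * (B * Q ^ m)" by simp
    also have "\<dots> \<le> 2 ^ m * (B * Q ^ m)"
    proof (rule mult_right_mono)
      have "Suc m \<le> 2 ^ m" by (simp add: Suc_leI)
      then show "real (Suc m) \<le> 2 ^ m" by (metis of_nat_le_iff of_nat_numeral of_nat_power)
    qed (use B0 Q in auto)
    also have "\<dots> = B * (2 * Q) ^ m" by (simp add: power_mult_distrib mult_ac)
    finally show ?thesis .
  qed
  show thesis by (rule that[of "2 * Q"]) (use Q main in auto)
qed

section \<open>Small monic polynomials force transfinite diameter zero\<close>

text \<open>Lagrange interpolation at \<open>Suc n\<close> nodes reproduces \<open>p\<close>; the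
  identity compares the coefficients of degree \<open>n\<close>.\<close>

lemma lagrange_leading_coeff:
  fixes p :: "complex poly"
  assumes "finite S" "card S = Suc n" "degree p = n" "lead_coeff p = 1"
  shows "(\<Sum>x\<in>S. poly p x / (\<Prod>y\<in>S - {x}. x - y)) = 1"
proof -
  define a where "a = (\<lambda>x. poly p x / (\<Prod>y\<in>S - {x}. x - y))"
  define l where "l = (\<lambda>x. \<Prod>y\<in>S - {x}. [:- y, 1:])"
  define q where "q = (\<Sum>x\<in>S. smult (a x) (l x))"
  have l: "degree (l x) = n" "lead_coeff (l x) = 1" if "x \<in> S" for x
    using linear_factors_prod[of "S - {x}" "\<lambda>y. y"] that assms by (auto simp: l_def)
  have "poly p u = poly q u" if u: "u \<in> S" for u
  proof -
    have "poly q u = (\<Sum>x\<in>S. if x = u then poly p u else 0)"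
      unfolding q_def poly_sum
    proof (rule sum.cong[OF refl])
      fix x assume x: "x \<in> S"
      show "poly (smult (a x) (l x)) u = (if x = u then poly p u else 0)"
      proof (cases "x = u")
        case True
        have "(\<Prod>y\<in>S - {u}. u - y) \<noteq> 0" using assms(1) by auto
        then show ?thesis using True by (simp add: l_def poly_prod a_def)
      next
        case False
        then have "poly (l x) u = 0" using u assms(1) by (auto simp: l_def poly_prod)
        then show ?thesis using False by simp
      qed
    qed
    then show ?thesis using u assms(1) by simp
  qed
  moreover have "degree q \<le> n"
    unfolding q_def using l(1) assms(1) by (intro degree_sum_le) (auto intro: order_trans[OF degree_smult_le])
  ultimately have "p = q"
    using assms by (intro poly_eqI_degree[of S]) auto
  have "1 = coeff q n" using \<open>p = q\<close> assms by auto
  also have "\<dots> = (\<Sum>x\<in>S. a x)"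
    unfolding q_def coeff_sum using l by (intro sum.cong) auto
  finally show ?thesis by (simp add: a_def)
qed

text \<open>If every node product were larger, each of the \<open>Suc n\<close> terms in the
  Lagrange identity would have modulus below \<open>1 / Suc n\<close>, and they could not sum to
  1.\<close>

lemma exists_small_node_product:
  fixes p :: "complex poly"
  assumes "finite S" "card S = Suc n" "degree p = n" "lead_coeff p = 1"
  shows "\<exists>x\<in>S. (\<Prod>y\<in>S - {x}. cmod (x - y)) \<le> real (Suc n) * cmod (poly p x)"
proof (rule ccontr)
  assume "\<not> ?thesis"
  then have less: "real (Suc n) * cmod (poly p x) < (\<Prod>y\<in>S - {x}. cmod (x - y))" if "x \<in> S" for x
    using that by auto
  have "S \<noteq> {}" using assms by auto
  have "1 = cmod (\<Sum>x\<in>S. poly p x / (\<Prod>y\<in>S - {x}. x - y))"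
    using lagrange_leading_coeff[OF assms] by simp
  also have "\<dots> \<le> (\<Sum>x\<in>S. cmod (poly p x) / (\<Prod>y\<in>S - {x}. cmod (x - y)))"
    by (rule order_trans[OF norm_sum]) (simp add: norm_divide prod_norm[symmetric])
  also have "\<dots> < (\<Sum>x\<in>S. 1 / real (Suc n))"
  proof (rule sum_strict_mono[OF assms(1) \<open>S \<noteq> {}\<close>])
    fix x assume x: "x \<in> S"
    have "(\<Prod>y\<in>S - {x}. cmod (x - y)) > 0" using assms(1) by (intro prod_pos) auto
    then show "cmod (poly p x) / (\<Prod>y\<in>S - {x}. cmod (x - y)) < 1 / real (Suc n)"
      using less[OF x] by (simp add: field_simps)
  qed
  also have "\<dots> = 1" using assms by simp
  finally show False by simp
qed

text \<open>Remove a node whose product of distances is at most \<open>Suc n * N n\<close> and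
  recurse; each removal divides the discriminant by the square of such a product.\<close>

lemma discr_le_of_monic_polys:
  fixes p :: "nat \<Rightarrow> complex poly"
  assumes "\<And>j. degree (p j) = j" "\<And>j. lead_coeff (p j) = 1"
    and "finite S" "\<And>j s. s \<in> S \<Longrightarrow> cmod (poly (p j) s) \<le> N j"
  shows "discr S \<le> (\<Prod>j<card S. real (Suc j) * N j)\<^sup>2"
  using assms(3,4)
proof (induction "card S" arbitrary: S)
  case 0
  then show ?case by (simp add: discr_def)
next
  case (Suc n)
  obtain x where x: "x \<in> S" and le: "(\<Prod>y\<in>S - {x}. cmod (x - y)) \<le> real (Suc n) * cmod (poly (p n) x)"
    using exists_small_node_product[OF Suc.prems(1) Suc(2)[symmetric] assms(1,2)] by blast
  let ?S = "S - {x}"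
  have card: "card ?S = n" using Suc x by simp
  have N0: "N j \<ge> 0" for j using Suc.prems(2)[OF x] norm_ge_zero order_trans by blast
  have "discr S = discr ?S * (\<Prod>y\<in>?S. cmod (x - y))\<^sup>2"
    using discr_insert[of ?S x] Suc.prems(1) x by (simp add: insert_absorb)
  also have "\<dots> \<le> (\<Prod>j<n. real (Suc j) * N j)\<^sup>2 * (real (Suc n) * N n)\<^sup>2"
  proof (rule mult_mono)
    show "discr ?S \<le> (\<Prod>j<n. real (Suc j) * N j)\<^sup>2"
      using Suc.hyps(1)[of ?S] card Suc.prems by auto
    have "real (Suc n) * cmod (poly (p n) x) \<le> real (Suc n) * N n"
      using Suc.prems(2)[OF x] by (intro mult_left_mono) auto
    then show "(\<Prod>y\<in>?S. cmod (x - y))\<^sup>2 \<le> (real (Suc n) * N n)\<^sup>2"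
      by (intro power_mono prod_nonneg order_trans[OF le]) auto
  qed auto
  also have "\<dots> = (\<Prod>j<Suc n. real (Suc j) * N j)\<^sup>2" by (simp only: prod.lessThan_Suc power_mult_distrib)
  finally show ?case using Suc(2) by simp
qed

lemma eventually_square_le_power2: "\<forall>\<^sub>F k in sequentially. (real k * H)\<^sup>2 \<le> 2 ^ (k - 1)"
proof -
  have "(\<lambda>k. real k ^ 2 / 2 ^ k) \<longlonglongrightarrow> 0"
  proof -
    have "(\<lambda>k. (real k * sqrt (1/2) ^ k)\<^sup>2) \<longlonglongrightarrow> 0\<^sup>2"
      by (intro tendsto_power powser_times_n_limit_0) (simp add: real_sqrt_lt_1_iff)
    moreover have "(real k * sqrt (1/2) ^ k)\<^sup>2 = real k ^ 2 / 2 ^ k" for k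
    proof -
      have "(sqrt (1/2) ^ k)\<^sup>2 = ((sqrt (1/2))\<^sup>2) ^ k" by (simp only: power_mult[symmetric] mult.commute)
      then show ?thesis by (simp add: power_mult_distrib power_divide)
    qed
    ultimately show ?thesis by simp
  qed
  then have "\<forall>\<^sub>F k in sequentially. real k ^ 2 / 2 ^ k < 1 / (2 * (H\<^sup>2 + 1))"
    by (rule order_tendstoD) (auto simp: add_nonneg_pos)
  moreover have "\<forall>\<^sub>F k in sequentially. (k :: nat) \<ge> 1" by (rule eventually_ge_at_top)
  ultimately show ?thesis
  proof eventually_elim
    case (elim k)
    have pos: "2 * (H\<^sup>2 + 1) > 0" by (simp add: add_nonneg_pos)
    have "real k ^ 2 * (2 * (H\<^sup>2 + 1)) < 2 ^ k" using elim(1) pos by (simp add: field_simps)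
    moreover have "(2 :: real) ^ k = 2 * 2 ^ (k - 1)" using elim(2) by (cases k) auto
    ultimately have "real k ^ 2 * (H\<^sup>2 + 1) < 2 ^ (k - 1)" by (simp add: algebra_simps)
    moreover have "(real k * H)\<^sup>2 \<le> real k ^ 2 * (H\<^sup>2 + 1)" by (simp add: power_mult_distrib mult_left_mono)
    ultimately show ?case by linarith
  qed
qed

text \<open>Powers of a single \<open>p\<close>, filled up by powers of the variable, give monic
  polynomials of every degree \<open>j\<close> bounded on \<open>K\<close> by
  \<open>H * \<epsilon> ^ j\<close>. The discriminant bound then loses only
  \<open>(k * H) ^ (2 * k)\<close>, which is below \<open>2 ^ (k * (k - 1))\<close> for large
  \<open>k\<close>; this explains \<open>2 * \<epsilon>\<close>.\<close>

lemma transfinite_diameter_eq_0: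
  assumes K: "bounded K"
    and small: "\<And>\<epsilon>. 0 < \<epsilon> \<Longrightarrow> \<epsilon> < 1 \<Longrightarrow>
      \<exists>p. lead_coeff p = 1 \<and> degree p > 0 \<and> (\<forall>s\<in>K. cmod (poly p s) \<le> \<epsilon> ^ degree p)"
  shows "transfinite_diameter K = 0"
proof (cases "K = {}")
  case True
  then show ?thesis by (simp add: transfinite_diameter_def diam_k_def limI)
next
  case False
  obtain R0 where R0: "\<And>x. x \<in> K \<Longrightarrow> cmod x \<le> R0" using K by (auto simp: bounded_iff)
  define R where "R = max R0 1"
  have R: "\<And>x. x \<in> K \<Longrightarrow> cmod x \<le> R" "R \<ge> 1" using R0 by (auto simp: R_def intro: max.coboundedI1)
  have le: "transfinite_diameter K \<le> 2 * \<epsilon>" if e: "0 < \<epsilon>" "\<epsilon> < 1" for \<epsilon>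
  proof -
    obtain p where p: "lead_coeff p = 1" "degree p > 0" "\<And>s. s \<in> K \<Longrightarrow> cmod (poly p s) \<le> \<epsilon> ^ degree p"
      using small[OF e] by blast
    define d where "d = degree p"
    have "p \<noteq> 0" using p(2) by auto
    define P where "P = (\<lambda>j. p ^ (j div d) * [:0, 1:] ^ (j mod d))"
    have P: "degree (P j) = j" "lead_coeff (P j) = 1" for j
    proof -
      have "degree (P j) = j div d * d + j mod d"
        unfolding P_def d_def using \<open>p \<noteq> 0\<close> by (simp add: degree_mult_eq degree_power_eq)
      then show "degree (P j) = j" by simp
      show "lead_coeff (P j) = 1"
        unfolding P_def lead_coeff_mult lead_coeff_power using p(1) by simp
    qed
    \<comment> \<open>Pays for the at most \<open>d\<close> extra factors of modulus up to
      \<open>R\<close> and for the powers of \<open>\<epsilon>\<close> that they fail to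
      supply.\<close>
    define H where "H = (R / \<epsilon>) ^ d"
    have H: "H \<ge> 1" unfolding H_def using R e by (intro one_le_power) (auto simp: field_simps)
    have PN: "cmod (poly (P j) s) \<le> H * \<epsilon> ^ j" if s: "s \<in> K" for j s
    proof -
      have "cmod (poly (P j) s) = cmod (poly p s) ^ (j div d) * cmod s ^ (j mod d)"
        by (simp add: P_def norm_mult norm_power poly_power)
      also have "\<dots> \<le> (\<epsilon> ^ d) ^ (j div d) * R ^ (j mod d)"
        using p(3)[OF s] R(1)[OF s] e R(2) by (intro mult_mono power_mono) (auto simp: d_def)
      also have "\<dots> \<le> (\<epsilon> ^ d) ^ (j div d) * (R ^ d * (\<epsilon> ^ (j mod d) / \<epsilon> ^ d))"
      proof (intro mult_left_mono)
        have md: "j mod d \<le> d" using p(2) by (simp add: d_def less_imp_le)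
        then have "\<epsilon> ^ d \<le> \<epsilon> ^ (j mod d)" using e by (intro power_decreasing) auto
        then have "1 \<le> \<epsilon> ^ (j mod d) / \<epsilon> ^ d" using e by simp
        moreover have "R ^ (j mod d) \<le> R ^ d" using md R by (intro power_increasing) auto
        ultimately have "R ^ (j mod d) * 1 \<le> R ^ d * (\<epsilon> ^ (j mod d) / \<epsilon> ^ d)"
          using R(2) by (intro mult_mono) auto
        then show "R ^ (j mod d) \<le> R ^ d * (\<epsilon> ^ (j mod d) / \<epsilon> ^ d)" by simp
      qed (use e in auto)
      also have "\<dots> = H * ((\<epsilon> ^ d) ^ (j div d) * \<epsilon> ^ (j mod d))"
        by (simp add: H_def power_divide)
      also have "(\<epsilon> ^ d) ^ (j div d) * \<epsilon> ^ (j mod d) = \<epsilon> ^ j"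
        by (metis mult_div_mod_eq power_add power_mult)
      finally show ?thesis .
    qed
    have "\<forall>\<^sub>F k in sequentially. diam_k k K \<le> 2 * \<epsilon>"
      using eventually_square_le_power2[of H] eventually_ge_at_top[of 2]
    proof eventually_elim
      case (elim k)
      have "discr S \<le> (2 * \<epsilon>) ^ (k * (k - 1))" if S: "S \<subseteq> K" "finite S" "card S = k" for S
      proof -
        have "discr S \<le> (\<Prod>j<k. real (Suc j) * (H * \<epsilon> ^ j))\<^sup>2"
          using discr_le_of_monic_polys[OF P S(2), of "\<lambda>j. H * \<epsilon> ^ j"] PN S by auto
        also have "\<dots> \<le> (\<Prod>j<k. (real k * H) * \<epsilon> ^ j)\<^sup>2"
          using H e by (intro power_mono prod_mono prod_nonneg) (auto simp: mult_right_mono)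
        also have "(\<Prod>j<k. (real k * H) * \<epsilon> ^ j) = (real k * H) ^ k * \<epsilon> ^ (\<Sum>j<k. j)"
          by (simp add: prod.distrib power_sum)
        also have "((real k * H) ^ k * \<epsilon> ^ (\<Sum>j<k. j))\<^sup>2 = ((real k * H)\<^sup>2) ^ k * \<epsilon> ^ (2 * (\<Sum>j<k. j))"
          by (simp only: power_mult_distrib power_mult[symmetric] mult.commute)
        also have "2 * (\<Sum>j<k. j) = k * (k - 1)"
          by (induction k) (auto simp: algebra_simps)
        also have "((real k * H)\<^sup>2) ^ k * \<epsilon> ^ (k * (k - 1)) \<le> (2 ^ (k - 1)) ^ k * \<epsilon> ^ (k * (k - 1))"
          using elim(1) e by (intro mult_right_mono power_mono) auto
        also have "\<dots> = (2 * \<epsilon>) ^ (k * (k - 1))"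
          by (simp only: power_mult_distrib power_mult[symmetric] mult.commute)
        finally show ?thesis .
      qed
      then show ?case using diam_k_le_iff[OF K False elim(2)] e by auto
    qed
    then show ?thesis
      by (rule tendsto_upperbound[OF diam_k_LIMSEQ[OF K]]) simp
  qed
  have "transfinite_diameter K \<le> 0"
  proof (rule ccontr)
    assume "\<not> ?thesis"
    then have "transfinite_diameter K > 0" by simp
    moreover have "transfinite_diameter K \<le> 1" using le[of "1/2"] by simp
    ultimately show False using le[of "transfinite_diameter K / 4"] by simp
  qed
  then show ?thesis using transfinite_diameter_nonneg[OF K] by simp
qed

text \<open>Replaces countable subadditivity of capacity. The polynomial for \<open>S n\<close> is
  small with exponent \<open>2 ^ Suc n\<close> and enters a finite product with degree proportional
  to \<open>2 ^ (M - n)\<close>. Wherever one factor is small, its contribution has exponent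
  \<open>2 ^ Suc M\<close> independently of \<open>n\<close>, which outweighs the total
  degree.\<close>

lemma transfinite_diameter_Union_eq_0:
  fixes S :: "nat \<Rightarrow> complex set"
  assumes K: "compact K" and cov: "K = (\<Union>n. S n)"
    and null: "\<And>n. S n \<noteq> {} \<Longrightarrow> cheb_null (S n)"
  shows "transfinite_diameter K = 0"
proof (rule transfinite_diameter_eq_0)
  show "bounded K" using K compact_imp_bounded by blast
  then obtain R where R: "\<And>x. x \<in> K \<Longrightarrow> cmod x \<le> R" by (auto simp: bounded_iff)
  fix \<epsilon> :: real assume e: "0 < \<epsilon>" "\<epsilon> < 1"
  define D where "D = max 1 (2 * R)"
  have D: "D \<ge> 1" "cmod (x - y) \<le> D" if "x \<in> K" "y \<in> K" for x y
    using R[of x] R[of y] that norm_triangle_ineq4[of x y] by (auto simp: D_def)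
  have D1: "D \<ge> 1" by (simp add: D_def)
  \<comment> \<open>Factors not known to be small at a point are still at most \<open>D\<close> per
    degree; \<open>\<eta> * D = \<epsilon>\<close> compensates for them.\<close>
  define \<eta> where "\<eta> = \<epsilon> / D"
  have \<eta>: "0 < \<eta>" "\<eta> < 1" using e D1 by (auto simp: \<eta>_def field_simps)
  show "\<exists>p. lead_coeff p = 1 \<and> degree p > 0 \<and> (\<forall>s\<in>K. cmod (poly p s) \<le> \<epsilon> ^ degree p)"
  proof (cases "K = {}")
    case True
    then show ?thesis by (intro exI[of _ "[:0, 1:]"]) auto
  next
    case False
    have "\<exists>p. lead_coeff p = 1 \<and> degree p > 0 \<and> (\<forall>s\<in>K. cmod (poly p s) \<le> D ^ degree p)
        \<and> (\<forall>s\<in>S n. cmod (poly p s) < (\<eta> ^ 2 ^ Suc n) ^ degree p)" for n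
    proof -
      have *: ?thesis if k: "k > 0" and z: "\<forall>i<k. z i \<in> K"
        and s: "\<forall>s\<in>S n. (\<Prod>i<k. cmod (s - z i)) < (\<eta> ^ 2 ^ Suc n) ^ k" for k and z :: "nat \<Rightarrow> complex"
      proof (intro exI[of _ "\<Prod>i<k. [:- z i, 1:]"] conjI ballI)
        have deg: "degree (\<Prod>i<k. [:- z i, 1:]) = k" using linear_factors_prod(1)[of "{..<k}" z] by simp
        show "lead_coeff (\<Prod>i<k. [:- z i, 1:]) = 1" using linear_factors_prod(2)[of "{..<k}" z] by simp
        show "degree (\<Prod>i<k. [:- z i, 1:]) > 0" using deg k by simp
        have nrm: "cmod (poly (\<Prod>i<k. [:- z i, 1:]) s) = (\<Prod>i<k. cmod (s - z i))" for s
          by (simp add: poly_prod prod_norm[symmetric])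
        show "cmod (poly (\<Prod>i<k. [:- z i, 1:]) u) \<le> D ^ degree (\<Prod>i<k. [:- z i, 1:])" if "u \<in> K" for u
        proof -
          have "(\<Prod>i<k. cmod (u - z i)) \<le> (\<Prod>i<k. D)"
            using D(2)[OF that] z by (intro prod_mono) auto
          then show ?thesis unfolding nrm deg by simp
        qed
        show "cmod (poly (\<Prod>i<k. [:- z i, 1:]) u) < (\<eta> ^ 2 ^ Suc n) ^ degree (\<Prod>i<k. [:- z i, 1:])"
          if "u \<in> S n" for u
          unfolding nrm deg using s that by blast
      qed
      show ?thesis
      proof (cases "S n = {}")
        case True
        obtain x where "x \<in> K" using False by blast
        then show ?thesis using *[of 1 "\<lambda>_. x"] True by simp
      next
        case False
        \<comment> \<open>Halving makes the inequality on \<open>S n\<close> strict, so that it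
          persists on an open neighbourhood and compactness of \<open>K\<close> applies.\<close>
        have h: "\<eta> ^ 2 ^ Suc n / 2 > 0" using \<eta> by simp
        then obtain k z where k: "k > 0" and z: "\<forall>i<k. z i \<in> S n"
          and s: "\<forall>s\<in>S n. (\<Prod>i<k. cmod (s - z i)) \<le> (\<eta> ^ 2 ^ Suc n / 2) ^ k"
          using null[OF False] unfolding cheb_null_def by blast
        have "(\<eta> ^ 2 ^ Suc n / 2) ^ k < (\<eta> ^ 2 ^ Suc n) ^ k"
          using h k by (intro power_strict_mono) auto
        then have "\<forall>s\<in>S n. (\<Prod>i<k. cmod (s - z i)) < (\<eta> ^ 2 ^ Suc n) ^ k"
          using s by (meson le_less_trans)
        moreover have "\<forall>i<k. z i \<in> K" using z cov by blast
        ultimately show ?thesis using *[of k z] k by blast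
      qed
    qed
    then obtain p where p: "\<And>n. lead_coeff (p n) = 1" "\<And>n. degree (p n) > 0"
      "\<And>n s. s \<in> K \<Longrightarrow> cmod (poly (p n) s) \<le> D ^ degree (p n)"
      "\<And>n s. s \<in> S n \<Longrightarrow> cmod (poly (p n) s) < (\<eta> ^ 2 ^ Suc n) ^ degree (p n)"
      by metis
    define U where "U = (\<lambda>n. {s. cmod (poly (p n) s) < (\<eta> ^ 2 ^ Suc n) ^ degree (p n)})"
    have "open (U n)" for n
      unfolding U_def by (intro open_Collect_less continuous_intros)
    moreover have "K \<subseteq> (\<Union>n\<in>UNIV. U n)" using cov p(4) by (auto simp: U_def)
    ultimately obtain F where F: "finite F" "K \<subseteq> (\<Union>n\<in>F. U n)"
      using compactE_image[OF K, of UNIV U] by metis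
    have Fne: "F \<noteq> {}" using F False by auto
    define M where "M = Max F"
    have M: "n \<le> M" if "n \<in> F" for n using F that by (simp add: M_def)
    define L where "L = (\<Prod>n\<in>F. degree (p n))"
    have L: "L > 0" using p(2) by (simp add: L_def prod_pos)
    \<comment> \<open>\<open>L\<close> is a common multiple of the degrees, so the
      \<open>n\<close>-th factor of \<open>Q\<close> has degree exactly
      \<open>2 ^ (M - n) * L\<close>.\<close>
    define e' where "e' = (\<lambda>n. 2 ^ (M - n) * (L div degree (p n)))"
    have deg_e': "degree (p n) * e' n = 2 ^ (M - n) * L" if "n \<in> F" for n
    proof -
      have "degree (p n) dvd L" using F that by (auto simp: L_def)
      then show ?thesis by (simp add: e'_def)
    qed
    define Q where "Q = (\<Prod>n\<in>F. p n ^ e' n)"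
    have pn0: "p n \<noteq> 0" for n using p(2)[of n] by auto
    have degQ: "degree Q = (\<Sum>n\<in>F. 2 ^ (M - n) * L)"
    proof -
      have "degree Q = (\<Sum>n\<in>F. degree (p n ^ e' n))"
        unfolding Q_def using pn0 by (intro degree_prod_eq_sum_degree) auto
      also have "\<dots> = (\<Sum>n\<in>F. 2 ^ (M - n) * L)"
        using deg_e' by (intro sum.cong) (auto simp: degree_power_eq pn0 mult.commute)
      finally show ?thesis .
    qed
    have degQ_le: "degree Q \<le> 2 ^ Suc M * L"
    proof -
      have "(\<Sum>n\<in>F. 2 ^ (M - n)) \<le> (\<Sum>n\<le>M. 2 ^ (M - n) :: nat)"
        using M by (intro sum_mono2) auto
      also have "\<dots> = (\<Sum>n\<le>M. 2 ^ n)"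
        by (rule sum.reindex_bij_witness[of _ "\<lambda>n. M - n" "\<lambda>n. M - n"]) auto
      also have "\<dots> \<le> 2 ^ Suc M" by (induction M) auto
      finally show ?thesis unfolding degQ sum_distrib_right[symmetric] by (intro mult_right_mono) auto
    qed
    show ?thesis
    proof (intro exI[of _ Q] conjI ballI)
      show "lead_coeff Q = 1" unfolding Q_def lead_coeff_prod lead_coeff_power p(1) by simp
      show "degree Q > 0"
        unfolding degQ using F(1) Fne L by (intro sum_pos) auto
      fix s assume s: "s \<in> K"
      then obtain n where n: "n \<in> F" "s \<in> U n" using F by blast
      have "cmod (poly Q s) = (\<Prod>j\<in>F. cmod (poly (p j) s) ^ e' j)"
        by (simp add: Q_def poly_prod poly_power norm_power prod_norm[symmetric])
      also have "\<dots> = cmod (poly (p n) s) ^ e' n * (\<Prod>j\<in>F - {n}. cmod (poly (p j) s) ^ e' j)"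
        using F n by (simp add: prod.remove)
      also have "\<dots> \<le> \<eta> ^ degree Q * (\<Prod>j\<in>F. D ^ (2 ^ (M - j) * L))"
      proof (rule mult_mono)
        have "cmod (poly (p n) s) ^ e' n \<le> ((\<eta> ^ 2 ^ Suc n) ^ degree (p n)) ^ e' n"
          using n by (intro power_mono) (auto simp: U_def)
        also have "\<dots> = \<eta> ^ (2 ^ Suc n * (degree (p n) * e' n))"
          by (simp only: power_mult mult.assoc)
        also have "2 ^ Suc n * (degree (p n) * e' n) = 2 ^ (Suc n + (M - n)) * L"
          unfolding deg_e'[OF n(1)] by (simp only: power_add mult.assoc)
        also have "Suc n + (M - n) = Suc M" using M[OF n(1)] by simp
        also have "\<eta> ^ (2 ^ Suc M * L) \<le> \<eta> ^ degree Q"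
          using degQ_le \<eta> by (intro power_decreasing) auto
        finally show "cmod (poly (p n) s) ^ e' n \<le> \<eta> ^ degree Q" .
        have "(\<Prod>j\<in>F - {n}. cmod (poly (p j) s) ^ e' j) \<le> (\<Prod>j\<in>F - {n}. D ^ (2 ^ (M - j) * L))"
        proof (intro prod_mono conjI)
          fix j assume j: "j \<in> F - {n}"
          have "cmod (poly (p j) s) ^ e' j \<le> (D ^ degree (p j)) ^ e' j"
            using p(3)[OF s] by (intro power_mono) auto
          then show "cmod (poly (p j) s) ^ e' j \<le> D ^ (2 ^ (M - j) * L)"
            using deg_e' j by (simp flip: power_mult)
        qed auto
        also have "\<dots> \<le> (\<Prod>j\<in>F. D ^ (2 ^ (M - j) * L))"
          using F D1 by (intro prod_mono2) auto
        finally show "(\<Prod>j\<in>F - {n}. cmod (poly (p j) s) ^ e' j) \<le> (\<Prod>j\<in>F. D ^ (2 ^ (M - j) * L))" .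
      qed (use \<eta> in \<open>auto intro: prod_nonneg\<close>)
      also have "(\<Prod>j\<in>F. D ^ (2 ^ (M - j) * L)) = D ^ degree Q"
        by (simp add: degQ power_sum)
      also have "\<eta> ^ degree Q * D ^ degree Q = \<epsilon> ^ degree Q"
        using D1 by (simp add: \<eta>_def flip: power_mult_distrib)
      finally show "cmod (poly Q s) \<le> \<epsilon> ^ degree Q" .
    qed
  qed
qed

text \<open>Maximum principle for the reversed polynomial \<open>q\<close>: its value at 0 is 1,
  while on the unit circle its modulus is that of the monic polynomial at
  \<open>inverse s\<close>.\<close>

lemma not_cheb_null_cball: "\<not> cheb_null (cball 0 1)"
proof
  assume "cheb_null (cball 0 1)"
  then obtain k and z :: "nat \<Rightarrow> complex" where k: "k > 0"
    and le: "\<And>s. cmod s \<le> 1 \<Longrightarrow> (\<Prod>i<k. cmod (s - z i)) \<le> (1/2) ^ k"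
    unfolding cheb_null_def by (metis half_gt_zero_iff mem_cball_0 zero_less_one)
  define q where "q = (\<lambda>s. \<Prod>i<k. 1 - s * z i)"
  have "cmod (q 0) \<le> (1/2) ^ k"
  proof (rule maximum_modulus_frontier[of q "cball 0 1"])
    show "q holomorphic_on interior (cball 0 1)"
      unfolding q_def by (intro holomorphic_intros)
    show "continuous_on (closure (cball 0 1)) q"
      unfolding q_def by (intro continuous_intros)
    fix s :: complex assume "s \<in> frontier (cball 0 1)"
    then have s: "cmod s = 1" by (simp add: frontier_cball)
    have "cmod (1 - s * z i) = cmod (inverse s - z i)" for i
    proof -
      have "s \<noteq> 0" using s by auto
      then have "1 - s * z i = s * (inverse s - z i)" by (simp add: algebra_simps)
      then show ?thesis using s by (simp add: norm_mult)
    qed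
    then have "cmod (q s) = (\<Prod>i<k. cmod (inverse s - z i))"
      by (simp add: q_def prod_norm[symmetric])
    also have "\<dots> \<le> (1/2) ^ k" using s by (intro le) (simp add: norm_inverse)
    finally show "cmod (q s) \<le> (1/2) ^ k" .
  qed auto
  moreover have "(1/2 :: real) ^ k < 1" using k by (simp add: power_less_one_iff)
  ultimately show False by (simp add: q_def)
qed

section \<open>Convergence sets\<close>

text \<open>These are the coefficients of \<open>g(st, t, x)\<close>.\<close>

definition line_series :: "(nat \<Rightarrow> nat \<Rightarrow> ('n \<Rightarrow> nat) \<Rightarrow> complex) \<Rightarrow> complex \<Rightarrow> nat \<Rightarrow> ('n \<Rightarrow> nat) \<Rightarrow> complex" where
  "line_series g s m \<beta> = (\<Sum>i\<le>m. g i (m - i) \<beta> * s ^ i)"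

lemma conv_set_fsigma_zero_capacity:
  fixes g :: "nat \<Rightarrow> nat \<Rightarrow> ('n::finite \<Rightarrow> nat) \<Rightarrow> complex"
  assumes g: "\<not> conv_ytx g"
  defines "E \<equiv> {s. conv_tx (line_series g s)}"
  shows "fsigma_in euclidean E" "zero_capacity E"
proof -
  define S where "S = (\<lambda>N :: nat. {s. \<forall>m \<beta>. (m \<noteq> 0 \<or> \<beta> \<noteq> (\<lambda>_. 0)) \<longrightarrow>
      cmod (line_series g s m \<beta>) \<le> real N ^ (m + mdeg \<beta>)})"
  have E_eq: "E = (\<Union>N. S N)"
  proof
    show "E \<subseteq> (\<Union>N. S N)"
    proof
      fix s assume "s \<in> E"
      then obtain C where C: "\<And>m \<beta>. m \<noteq> 0 \<or> \<beta> \<noteq> (\<lambda>_. 0) \<Longrightarrow> cmod (line_series g s m \<beta>) \<le> C ^ (m + mdeg \<beta>)"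
        unfolding E_def conv_tx_def by blast
      obtain N :: nat where N: "\<bar>C\<bar> \<le> real N" using real_arch_simple by blast
      have "s \<in> S N"
        unfolding S_def
      proof (clarify)
        fix m :: nat and \<beta> :: "'n \<Rightarrow> nat" assume "m \<noteq> 0 \<or> \<beta> \<noteq> (\<lambda>_. 0)"
        then have "cmod (line_series g s m \<beta>) \<le> C ^ (m + mdeg \<beta>)" by (rule C)
        also have "\<dots> \<le> \<bar>C\<bar> ^ (m + mdeg \<beta>)" by (metis abs_ge_self power_abs)
        also have "\<dots> \<le> real N ^ (m + mdeg \<beta>)" using N by (intro power_mono) auto
        finally show "cmod (line_series g s m \<beta>) \<le> real N ^ (m + mdeg \<beta>)" .
      qed
      then show "s \<in> (\<Union>N. S N)" by blast
    qed
    show "(\<Union>N. S N) \<subseteq> E" unfolding S_def E_def conv_tx_def by blast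
  qed
  have closed_S: "closed (S N)" for N
    unfolding S_def line_series_def
    by (intro closed_Collect_all closed_Collect_imp open_Collect_const closed_Collect_le continuous_intros)
  then show "fsigma_in euclidean E"
    unfolding E_eq by (intro fsigma_in_Union) (auto intro!: closed_imp_fsigma_in)
  have null: "cheb_null (K \<inter> S N)" if K: "compact K" and ne: "K \<inter> S N \<noteq> {}" for K N
  proof (rule ccontr)
    assume nn: "\<not> cheb_null (K \<inter> S N)"
    have "bounded (K \<inter> S N)" using K compact_imp_bounded bounded_Int by blast
    then obtain D where D: "D \<ge> 1"
      "\<And>p m B k. degree p \<le> m \<Longrightarrow> (\<And>s. s \<in> K \<inter> S N \<Longrightarrow> cmod (poly p s) \<le> B) \<Longrightarrow> cmod (coeff p k) \<le> B * D ^ m"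
      using coeff_bound_of_not_cheb_null[OF _ ne nn] by metis
    \<comment> \<open>For fixed \<open>\<beta>\<close>, the entries with \<open>i + j = m\<close>
      are the coefficients of one polynomial in \<open>s\<close> that is bounded on
      \<open>S N\<close>. Recovering them costs only \<open>D ^ m\<close>, an exponential factor
      that convergence tolerates.\<close>
    have "cmod (g i j \<beta>) \<le> (real N * D) ^ (i + j + mdeg \<beta>)" if nz: "i \<noteq> 0 \<or> j \<noteq> 0 \<or> \<beta> \<noteq> (\<lambda>_. 0)" for i j \<beta>
    proof -
      define m where "m = i + j"
      define p where "p = (\<Sum>l\<le>m. monom (g l (m - l) \<beta>) l)"
      have "degree p \<le> m"
        unfolding p_def by (intro degree_sum_le) (auto intro: order_trans[OF degree_monom_le])
      moreover have "cmod (poly p s) \<le> real N ^ (m + mdeg \<beta>)" if "s \<in> K \<inter> S N" for s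
      proof -
        have "poly p s = line_series g s m \<beta>" by (simp add: p_def poly_sum poly_monom line_series_def)
        then show ?thesis using that nz by (auto simp: S_def m_def)
      qed
      ultimately have "cmod (coeff p i) \<le> real N ^ (m + mdeg \<beta>) * D ^ m" by (rule D(2))
      moreover have "coeff p i = g i j \<beta>"
        by (simp add: p_def coeff_sum m_def)
      ultimately have "cmod (g i j \<beta>) \<le> real N ^ (m + mdeg \<beta>) * D ^ m" by simp
      also have "\<dots> \<le> real N ^ (m + mdeg \<beta>) * D ^ (m + mdeg \<beta>)"
        using D(1) by (intro mult_left_mono power_increasing) auto
      finally show ?thesis by (simp add: m_def power_mult_distrib)
    qed
    then show False using g unfolding conv_ytx_def by blast
  qed
  show "zero_capacity E"
  proof (rule zero_capacityI)
    fix K assume K: "compact K" "K \<subseteq> E"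
    show "transfinite_diameter K = 0"
      using transfinite_diameter_Union_eq_0[OF K(1), of "\<lambda>N. K \<inter> S N"] null[OF K(1)] K(2) E_eq by blast
  qed
qed

section \<open>Construction of a series with prescribed convergence set\<close>

text \<open>Multiplying a monic polynomial that is small on \<open>K\<close> by a constant gives a \<open>p\<close> for which \<open>|p|\<^bsup>1/m\<^esup>\<close>
  is at most 1 on \<open>K\<close> and at least \<open>A\<close> at distance \<open>\<delta>\<close> from \<open>K\<close>; taking \<open>m\<close> to be a large multiple of
  the degree keeps it bounded by a multiple of \<open>A\<close> independent of \<open>\<delta>\<close>.\<close>

lemma separating_polynomial:
  assumes K: "\<And>x. x \<in> K \<Longrightarrow> cmod x \<le> R" "0 \<le> R" "K \<noteq> {} \<Longrightarrow> cheb_null K"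
    and A: "1 \<le> A" and d: "0 < \<delta>"
  shows "\<exists>m>M. \<exists>p. degree p \<le> m \<and> (\<forall>s\<in>K. cmod (poly p s) \<le> 1) \<and>
      (\<forall>s. (\<forall>x\<in>K. \<delta> \<le> cmod (s - x)) \<longrightarrow> A ^ m \<le> cmod (poly p s)) \<and>
      (\<forall>s. cmod (poly p s) \<le> (2 * A * (1 + R + cmod s)) ^ m)"
proof (cases "K = {}")
  case True
  have "A ^ Suc M \<le> (2 * A * (1 + R + cmod s)) ^ Suc M" for s
  proof (rule power_mono)
    have "A * 1 \<le> A * (2 * (1 + R + cmod s))" using A K(2) by (intro mult_left_mono) (auto simp: add_nonneg_nonneg)
    then show "A \<le> 2 * A * (1 + R + cmod s)" by (simp add: mult_ac)
  qed (use A in auto)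
  moreover have "cmod (of_real (A ^ Suc M)) = A ^ Suc M" using A by (simp add: norm_mult norm_power)
  ultimately show ?thesis
    using True by (intro exI[of _ "Suc M"] conjI exI[of _ "[:of_real (A ^ Suc M):]"]) (auto simp del: of_real_power power_Suc)
next
  case False
  \<comment> \<open>The power \<open>2 ^ n\<close> will absorb \<open>1 / \<delta>\<close>; this is
    why the final upper bound does not depend on \<open>\<delta>\<close>.\<close>
  obtain n0 where "1 / \<delta> < 2 ^ n0" using real_arch_pow[of 2] by auto
  define n where "n = Suc n0"
  have n: "1 / \<delta> \<le> 2 ^ n" "n > 0"
  proof -
    have "(2 :: real) ^ n0 \<le> 2 ^ n" by (simp add: n_def)
    then show "1 / \<delta> \<le> 2 ^ n" using \<open>1 / \<delta> < 2 ^ n0\<close> by linarith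
  qed (simp add: n_def)
  have "\<delta> / A ^ n > 0" using A d by simp
  from K(3)[OF False, unfolded cheb_null_def, rule_format, OF this]
  obtain k z where k: "k > 0" and z: "\<And>i. i < k \<Longrightarrow> z i \<in> K"
    and small: "\<And>s. s \<in> K \<Longrightarrow> (\<Prod>i<k. cmod (s - z i)) \<le> (\<delta> / A ^ n) ^ k"
    by auto
  define q where "q = Suc M"
  \<comment> \<open>Normalised so that the product is at most 1 on \<open>K\<close> and at least
    \<open>A ^ (n * k)\<close> at distance \<open>\<delta>\<close>.\<close>
  define c where "c = (A ^ n / \<delta>) ^ k"
  have c0: "c \<ge> 0" using A d by (simp add: c_def)
  define p where "p = (smult (of_real c) (\<Prod>i<k. [:- z i, 1:])) ^ q"
  \<comment> \<open>The degree of \<open>p\<close> is at most \<open>k * q\<close>; the extra factor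
    \<open>n\<close> in \<open>m\<close> dilutes the constant \<open>1 / \<delta>\<close>, and
    \<open>q\<close> only pushes \<open>m\<close> beyond \<open>M\<close>.\<close>
  define m where "m = n * k * q"
  have norm_p: "cmod (poly p s) = (c * (\<Prod>i<k. cmod (s - z i))) ^ q" for s
    using c0 by (simp add: p_def poly_power norm_power norm_mult poly_prod prod_norm[symmetric])
  have "n * k \<ge> 1" using n k by (simp add: Suc_leI)
  then have "1 * q \<le> m" unfolding m_def by (rule mult_le_mono1)
  then have "m > M" by (simp add: q_def)
  moreover have "degree p \<le> m"
  proof -
    have "degree (smult (of_real c) (\<Prod>i<k. [:- z i, 1:])) \<le> k"
      using linear_factors_prod(1)[of "{..<k}" z] order_trans[OF degree_smult_le] by simp
    then have "degree p \<le> k * q"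
      unfolding p_def by (intro order_trans[OF degree_power_le] mult_le_mono1)
    also have "\<dots> \<le> m" using n(2) by (simp add: m_def)
    finally show ?thesis .
  qed
  moreover have "cmod (poly p s) \<le> 1" if "s \<in> K" for s
  proof -
    have "c * (\<Prod>i<k. cmod (s - z i)) \<le> c * (\<delta> / A ^ n) ^ k"
      using small[OF that] c0 by (intro mult_left_mono)
    also have "\<dots> = 1" using A d by (simp add: c_def flip: power_mult_distrib)
    finally show ?thesis unfolding norm_p using c0 by (intro power_le_one mult_nonneg_nonneg prod_nonneg) auto
  qed
  moreover have "A ^ m \<le> cmod (poly p s)" if "\<forall>x\<in>K. \<delta> \<le> cmod (s - x)" for s
  proof -
    have "(\<Prod>i<k. \<delta>) \<le> (\<Prod>i<k. cmod (s - z i))"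
      using that z d by (intro prod_mono) auto
    then have "c * \<delta> ^ k \<le> c * (\<Prod>i<k. cmod (s - z i))"
      using c0 by (intro mult_left_mono) auto
    moreover have "c * \<delta> ^ k = A ^ (n * k)" using d by (simp add: c_def power_divide power_mult)
    ultimately have "(A ^ (n * k)) ^ q \<le> cmod (poly p s)"
      unfolding norm_p using A by (intro power_mono) auto
    then show ?thesis by (simp add: m_def power_mult)
  qed
  moreover have "cmod (poly p s) \<le> (2 * A * (1 + R + cmod s)) ^ m" for s
  proof -
    let ?B = "1 + R + cmod s"
    have B: "?B \<ge> 1" using K(2) by (simp add: add_nonneg_nonneg)
    have "(\<Prod>i<k. cmod (s - z i)) \<le> (\<Prod>i<k. ?B)"
    proof (intro prod_mono conjI)
      fix i assume "i \<in> {..<k}"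
      then show "cmod (s - z i) \<le> ?B"
        using K(1)[OF z, of i] norm_triangle_ineq4[of s "z i"] by simp
    qed auto
    moreover have "c \<le> ((A * 2) ^ n) ^ k"
    proof -
      have "A ^ n * (1 / \<delta>) \<le> A ^ n * 2 ^ n" using n(1) A by (intro mult_left_mono) auto
      then have "A ^ n / \<delta> \<le> (A * 2) ^ n" by (simp add: power_mult_distrib)
      then show ?thesis unfolding c_def using A d by (intro power_mono) auto
    qed
    ultimately have "c * (\<Prod>i<k. cmod (s - z i)) \<le> ((A * 2) ^ n) ^ k * ?B ^ k"
      using A by (intro mult_mono prod_nonneg) auto
    also have "\<dots> \<le> ((A * 2) ^ n) ^ k * (?B ^ n) ^ k"
    proof (intro mult_left_mono power_mono)
      have "?B ^ 1 \<le> ?B ^ n" using B n(2) by (intro power_increasing) auto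
      then show "?B \<le> ?B ^ n" by simp
    qed (use A B in auto)
    also have "\<dots> = (A * 2 * ?B) ^ (n * k)" by (simp only: power_mult power_mult_distrib)
    also have "A * 2 * ?B = 2 * A * ?B" by simp
    finally have "cmod (poly p s) \<le> ((2 * A * ?B) ^ (n * k)) ^ q"
      unfolding norm_p using c0 by (intro power_mono mult_nonneg_nonneg prod_nonneg) auto
    then show ?thesis by (simp add: m_def power_mult)
  qed
  ultimately show ?thesis by blast
qed

text \<open>Used contrapositively: a series whose convergence set is not the whole plane must
  diverge.\<close>

lemma conv_tx_line_series:
  fixes g :: "nat \<Rightarrow> nat \<Rightarrow> ('n::finite \<Rightarrow> nat) \<Rightarrow> complex"
  assumes "conv_ytx g"
  shows "conv_tx (line_series g s)"
proof -
  obtain C0 where C0: "\<And>k m \<beta>. k \<noteq> 0 \<or> m \<noteq> 0 \<or> \<beta> \<noteq> (\<lambda>_. 0) \<Longrightarrow> cmod (g k m \<beta>) \<le> C0 ^ (k + m + mdeg \<beta>)"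
    using assms unfolding conv_ytx_def by blast
  define C where "C = \<bar>C0\<bar>"
  define r where "r = 1 + cmod s"
  have r: "r \<ge> 1" "cmod s \<le> r" and "C \<ge> 0" by (auto simp: r_def C_def)
  have "cmod (line_series g s m \<beta>) \<le> (2 * C * r) ^ (m + mdeg \<beta>)" if nz: "m \<noteq> 0 \<or> \<beta> \<noteq> (\<lambda>_. 0)" for m \<beta>
  proof -
    let ?N = "m + mdeg \<beta>"
    have "cmod (line_series g s m \<beta>) \<le> (\<Sum>i\<le>m. cmod (g i (m - i) \<beta> * s ^ i))"
      unfolding line_series_def by (rule norm_sum)
    also have "\<dots> \<le> (\<Sum>i\<le>m. C ^ ?N * r ^ ?N)"
    proof (rule sum_mono)
      fix i assume i: "i \<in> {..m}"
      then have "cmod (g i (m - i) \<beta>) \<le> C0 ^ (i + (m - i) + mdeg \<beta>)" using nz by (intro C0) auto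
      also have "\<dots> \<le> C ^ ?N" using i by (simp add: C_def) (metis abs_ge_self power_abs)
      finally have "cmod (g i (m - i) \<beta>) \<le> C ^ ?N" .
      moreover have "cmod s ^ i \<le> r ^ ?N"
        using r i by (intro order_trans[OF power_mono power_increasing]) auto
      ultimately show "cmod (g i (m - i) \<beta> * s ^ i) \<le> C ^ ?N * r ^ ?N"
        unfolding norm_mult norm_power using \<open>C \<ge> 0\<close> by (intro mult_mono) auto
    qed
    also have "\<dots> = real (Suc m) * (C ^ ?N * r ^ ?N)" by simp
    also have "\<dots> \<le> 2 ^ ?N * (C ^ ?N * r ^ ?N)"
    proof (rule mult_right_mono)
      have "Suc m \<le> 2 ^ m" by (simp add: Suc_leI)
      also have "(2 :: nat) ^ m \<le> 2 ^ ?N" by (rule power_increasing) auto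
      finally show "real (Suc m) \<le> 2 ^ ?N" by (metis of_nat_le_iff of_nat_numeral of_nat_power)
    qed (use \<open>C \<ge> 0\<close> r in auto)
    finally show ?thesis by (simp add: power_mult_distrib mult_ac)
  qed
  then show ?thesis unfolding conv_tx_def by blast
qed

lemma exists_series_with_conv_set:
  assumes "fsigma_in euclidean E" and cap: "zero_capacity E"
  shows "\<exists>g :: nat \<Rightarrow> nat \<Rightarrow> ('n::finite \<Rightarrow> nat) \<Rightarrow> complex. \<not> conv_ytx g \<and> E = {s. conv_tx (line_series g s)}"
proof -
  obtain F :: "nat \<Rightarrow> complex set" where F: "\<And>n. closed (F n)" "\<And>n. F n \<subseteq> F (Suc n)" "(\<Union>n. F n) = E"
    using assms(1) unfolding fsigma_in_ascending by auto
  define K where "K = (\<lambda>n. F n \<inter> cball 0 (real n))"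
  have K_compact: "compact (K n)" for n
    unfolding K_def by (intro closed_Int_compact F compact_cball)
  have K_mono: "K m \<subseteq> K n" if "m \<le> n" for m n
    using lift_Suc_mono_le[of F m n, OF F(2) that] that by (auto simp: K_def)
  have K_Un: "(\<Union>n. K n) = E"
  proof
    show "(\<Union>n. K n) \<subseteq> E" using F(3) by (auto simp: K_def)
    show "E \<subseteq> (\<Union>n. K n)"
    proof
      fix s assume "s \<in> E"
      then obtain n where n: "s \<in> F n" using F(3) by blast
      obtain l where "cmod s \<le> real l" using real_arch_simple by blast
      then have "s \<in> K (max n l)"
        using n lift_Suc_mono_le[of F n "max n l", OF F(2)] by (auto simp: K_def)
      then show "s \<in> (\<Union>n. K n)" by blast
    qed
  qed
  have null: "cheb_null L" if L: "compact L" "L \<subseteq> E" "L \<noteq> {}" for L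
    using transfinite_diameter_pos[of L] zero_capacity_imp[OF cap L(1,2)] L compact_imp_bounded by force
  \<comment> \<open>The index \<open>i\<close> codes a pair: \<open>N\<close> selects the compact
    set and the growth \<open>Suc N\<close>, and \<open>j\<close> the distance
    \<open>1 / Suc j\<close>.\<close>
  define good where "good = (\<lambda>(i :: nat) (m, p). let (N, j) = prod_decode i in
    m > 0 \<and> degree p \<le> m \<and> (\<forall>s\<in>K N. cmod (poly p s) \<le> 1) \<and>
      (\<forall>s. (\<forall>x\<in>K N. 1 / real (Suc j) \<le> cmod (s - x)) \<longrightarrow> real (Suc N) ^ m \<le> cmod (poly p s)) \<and>
      (\<forall>s. cmod (poly p s) \<le> (2 * real (Suc N) * (1 + real N + cmod s)) ^ m))"
  have ex: "\<exists>m>M. \<exists>p. good i (m, p)" for M i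
  proof -
    obtain N j where ij: "prod_decode i = (N, j)" by (cases "prod_decode i")
    have "K N \<subseteq> E" using K_Un by blast
    then have "K N \<noteq> {} \<Longrightarrow> cheb_null (K N)" using null K_compact by blast
    then have "\<exists>m>M. \<exists>p. degree p \<le> m \<and> (\<forall>s\<in>K N. cmod (poly p s) \<le> 1) \<and>
      (\<forall>s. (\<forall>x\<in>K N. 1 / real (Suc j) \<le> cmod (s - x)) \<longrightarrow> real (Suc N) ^ m \<le> cmod (poly p s)) \<and>
      (\<forall>s. cmod (poly p s) \<le> (2 * real (Suc N) * (1 + real N + cmod s)) ^ m)"
      by (intro separating_polynomial) (auto simp: K_def)
    then show ?thesis by (auto simp: good_def ij)
  qed
  \<comment> \<open>Strictly increasing exponents ensure that no power of \<open>t\<close> receives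
    two polynomials.\<close>
  have "\<exists>f. \<forall>i. good i (f i) \<and> fst (f i) < fst (f (Suc i))"
  proof (rule dependent_nat_choice)
    show "\<exists>x. good 0 x" using ex by blast
    show "\<exists>y. good (Suc i) y \<and> fst x < fst y" for x i using ex[of "fst x" "Suc i"] by auto
  qed
  then obtain f where f: "\<And>i. good i (f i)" "\<And>i. fst (f i) < fst (f (Suc i))" by blast
  define mm where "mm = (\<lambda>i. fst (f i))"
  define pp where "pp = (\<lambda>i. snd (f i))"
  have mono: "strict_mono mm" unfolding mm_def using f(2) by (simp add: strict_mono_Suc_iff)
  have inj: "inj mm" using mono by (rule strict_mono_imp_inj_on)
  have good: "mm i > 0" "degree (pp i) \<le> mm i"
    "\<And>s. s \<in> K N \<Longrightarrow> cmod (poly (pp i) s) \<le> 1"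
    "\<And>s. (\<And>x. x \<in> K N \<Longrightarrow> 1 / real (Suc j) \<le> cmod (s - x)) \<Longrightarrow> real (Suc N) ^ mm i \<le> cmod (poly (pp i) s)"
    "\<And>s. cmod (poly (pp i) s) \<le> (2 * real (Suc N) * (1 + real N + cmod s)) ^ mm i"
    if "prod_decode i = (N, j)" for i N j
    using f(1)[of i] that by (auto simp: good_def mm_def pp_def case_prod_beta Let_def)
  define P where "P = (\<lambda>m. if m \<in> range mm then pp (inv mm m) else 0)"
  have P_mm: "P (mm i) = pp i" for i using inj by (simp add: P_def)
  have P_deg: "degree (P m) \<le> m" for m
  proof (cases "m \<in> range mm")
    case True
    then obtain i where "m = mm i" by blast
    then show ?thesis using P_mm good(2)[of i "fst (prod_decode i)" "snd (prod_decode i)"] by simp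
  qed (simp add: P_def)
  \<comment> \<open>Placing the coefficient of degree \<open>i\<close> at \<open>y ^ i t ^ j\<close>
    makes \<open>P m\<close> the coefficient of \<open>t ^ m\<close> in
    \<open>g(st, t, x)\<close>.\<close>
  define g where "g = (\<lambda>i j (\<beta> :: 'n \<Rightarrow> nat). if \<beta> = (\<lambda>_. 0) then coeff (P (i + j)) i else 0)"
  have ls: "line_series g s m \<beta> = (if \<beta> = (\<lambda>_. 0) then poly (P m) s else 0)" for s m \<beta>
  proof -
    have "poly (P m) s = (\<Sum>i\<le>m. coeff (P m) i * s ^ i)"
      unfolding poly_altdef using P_deg[of m]
      by (intro sum.mono_neutral_left) (auto simp: coeff_eq_0)
    then show ?thesis by (simp add: line_series_def g_def)
  qed
  have "conv_tx (line_series g s)" if s: "s \<in> E" for s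
  proof -
    obtain M where M: "s \<in> K M" using s K_Un by blast
    \<comment> \<open>From stage \<open>M\<close> on, \<open>s\<close> lies in every
      \<open>K N\<close> and the values are at most 1. For the stages below \<open>M\<close> the
      general bound applies; as it does not involve \<open>j\<close>, one constant serves infinitely
      many polynomials.\<close>
    define C where "C = 2 * real (Suc M) * (1 + real M + cmod s)"
    have C: "C \<ge> 1"
    proof -
      have "1 * 1 \<le> (2 * real (Suc M)) * (1 + real M + cmod s)" by (rule mult_mono) auto
      then show ?thesis by (simp add: C_def)
    qed
    have "cmod (poly (pp i) s) \<le> C ^ mm i" for i
    proof -
      obtain N j where ij: "prod_decode i = (N, j)" by (cases "prod_decode i")
      show ?thesis
      proof (cases "M \<le> N")
        case True
        then have "cmod (poly (pp i) s) \<le> 1" using good(3)[OF ij] M K_mono by blast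
        also have "1 \<le> C ^ mm i" using C by simp
        finally show ?thesis .
      next
        case False
        have "cmod (poly (pp i) s) \<le> (2 * real (Suc N) * (1 + real N + cmod s)) ^ mm i" by (rule good(5)[OF ij])
        also have "\<dots> \<le> C ^ mm i"
          unfolding C_def using False by (intro power_mono mult_mono) auto
        finally show ?thesis .
      qed
    qed
    then have "cmod (poly (P m) s) \<le> C ^ m" for m
      using P_mm C by (cases "m \<in> range mm") (auto simp: P_def)
    then have "cmod (line_series g s m \<beta>) \<le> C ^ (m + mdeg \<beta>)" for m \<beta>
      using C by (auto simp: ls mdeg_def)
    then show ?thesis unfolding conv_tx_def by blast
  qed
  moreover have "s \<in> E" if conv: "conv_tx (line_series g s)" for s
  proof (rule ccontr)
    assume s: "s \<notin> E"
    obtain C where C: "\<And>m \<beta>. m \<noteq> 0 \<or> \<beta> \<noteq> (\<lambda>_. 0) \<Longrightarrow> cmod (line_series g s m \<beta>) \<le> C ^ (m + mdeg \<beta>)"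
      using conv unfolding conv_tx_def by blast
    \<comment> \<open>\<open>N\<close> is chosen above \<open>C\<close>, and then \<open>j\<close>
      from the positive distance of \<open>s\<close> to the closed set \<open>K N\<close>. The
      polynomial of that pair is at least \<open>Suc N ^ mm i\<close> at \<open>s\<close>, too large
      for \<open>C\<close>.\<close>
    obtain N :: nat where N: "\<bar>C\<bar> \<le> real N" using real_arch_simple by blast
    have "s \<notin> K N" using s K_Un by blast
    then obtain e where e: "e > 0" "\<And>x. x \<in> K N \<Longrightarrow> e \<le> dist s x"
      using separate_point_closed[of "K N" s] K_compact[of N] compact_imp_closed by blast
    obtain j where j: "1 / real (Suc j) < e" using e(1) nat_approx_posE by blast
    define i where "i = prod_encode (N, j)"
    have ij: "prod_decode i = (N, j)" by (simp add: i_def)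
    have "real (Suc N) ^ mm i \<le> cmod (poly (pp i) s)"
      using e(2) j by (intro good(4)[OF ij]) (force simp: dist_norm)
    also have "\<dots> = cmod (line_series g s (mm i) (\<lambda>_. 0))" by (simp add: ls P_mm)
    also have "\<dots> \<le> C ^ (mm i + mdeg (\<lambda>_ :: 'n. 0))" using good(1)[OF ij] by (intro C) auto
    also have "\<dots> \<le> \<bar>C\<bar> ^ mm i" by (simp add: mdeg_def) (metis abs_ge_self power_abs)
    also have "\<dots> < real (Suc N) ^ mm i" using N good(1)[OF ij] by (intro power_strict_mono) auto
    finally show False by simp
  qed
  ultimately have E_eq: "E = {s. conv_tx (line_series g s)}" by blast
  moreover have "\<not> conv_ytx g"
  proof
    assume "conv_ytx g"
    \<comment> \<open>Convergence of \<open>g\<close> would put the unit disc into \<open>E\<close>,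
      although every nonempty compact subset of \<open>E\<close> is Chebyshev-null.\<close>
    then have "cball 0 1 \<subseteq> E" unfolding E_eq using conv_tx_line_series by blast
    then show False using null[of "cball 0 1"] not_cheb_null_cball by simp
  qed
  ultimately show ?thesis by blast
qed

theorem mainTheorem1:
  fixes b :: "nat \<Rightarrow> ('n::finite \<Rightarrow> nat) \<Rightarrow> complex" and E :: "complex set"
  assumes phi_conv: "conv_tx (phi b)"
    and b_conv: "\<forall>j\<ge>1. conv_x (b j)"
    and b10: "b 1 (\<lambda>_. 0) = 1"
  shows "(\<exists>f :: nat \<Rightarrow> nat \<Rightarrow> ('n \<Rightarrow> nat) \<Rightarrow> complex. \<not> conv_ytx f \<and> E = Conv_phi b f)
     \<longleftrightarrow> (fsigma_in euclidean E \<and> zero_capacity E)"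
proof -
  obtain T :: "(nat \<Rightarrow> nat \<Rightarrow> ('n \<Rightarrow> nat) \<Rightarrow> complex) \<Rightarrow> nat \<Rightarrow> nat \<Rightarrow> ('n \<Rightarrow> nat) \<Rightarrow> complex"
    where T: "surj T" "\<And>f. conv_ytx (T f) \<longleftrightarrow> conv_ytx f"
      "\<And>f s m \<beta>. subst_y f (phi_s b s) m \<beta> = (\<Sum>i\<le>m. T f i (m - i) \<beta> * s ^ i)"
    using straighten[OF phi_conv b10] by blast
  have Conv: "Conv_phi b f = {s. conv_tx (line_series (T f) s)}" for f
  proof -
    have "subst_y f (phi_s b s) = line_series (T f) s" for s
      by (intro ext) (simp add: T(3) line_series_def)
    then show ?thesis by (simp add: Conv_phi_def)
  qed
  show ?thesis
  proof
    assume "\<exists>f. \<not> conv_ytx f \<and> E = Conv_phi b f"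
    then obtain f where "\<not> conv_ytx (T f)" "E = {s. conv_tx (line_series (T f) s)}"
      using T(2) Conv by auto
    then show "fsigma_in euclidean E \<and> zero_capacity E"
      using conv_set_fsigma_zero_capacity by blast
  next
    assume "fsigma_in euclidean E \<and> zero_capacity E"
    then obtain g :: "nat \<Rightarrow> nat \<Rightarrow> ('n \<Rightarrow> nat) \<Rightarrow> complex"
      where g: "\<not> conv_ytx g" "E = {s. conv_tx (line_series g s)}"
      using exists_series_with_conv_set by blast
    obtain f where "g = T f" using T(1) by (metis surjD)
    then show "\<exists>f. \<not> conv_ytx f \<and> E = Conv_phi b f"
      using g T(2) Conv by auto
  qed
qed

end
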